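(* Let $X$ be a Banach space with the lifting property and let $G$ be a bounded group of automorphisms of $X$ which is compact in the strong operator topology (SOT), with associated (normalized) Haar measure $\mu$. Then for any bounded linear right inverse $T_0\colon X\to\mathcal F(X)$ of the barycenter map $\beta_X$, the mapping $T\colon X\to\mathcal F(X)$ defined by $$T(x)=\int_{g\in G}\tilde g\,T_0\,g^{-1}(x)\,d\mu\qquad\text{for every }x\in X$$ (Bochner integral) is a $G$-equivariant bounded linear right inverse of $\beta_X$. Furthermore, if $\|T_0\|\le 1$ and $G$ is a group of isometries, then $\|T\|\le 1$.
   Context: Banach spaces are real (a complex space is regarded as a real one). For a metric space $M$ with base point $0$, $\mathrm{Lip}_0(M)$ is the Banach space of Lipschitz functions $f\colon M\to\mathbb R$ with $f(0)=0$, normed by the least Lipschitz constant; $\delta\colon M\to \mathrm{Lip}_0(M)^*$ is given by $\langle f,\delta(x)\rangle=f(x)$; the Lipschitz-free space is $\mathcal F(M)=\overline{\mathrm{span}}\,\delta(M)\subset \mathrm{Lip}_0(M)^*$. For a Banach space $X$ (base point $0$), every Lipschitz map $L\colon X\to Y$ into a Banach space $Y$ with $L(0)=0$ extends uniquely to a bounded linear $\overline L\colon\mathcal F(X)\to Y$ with $\overline L\delta=L$ and $\|\overline L\|=\mathrm{Lip}(L)$. The barycenter map is $\beta_X=\overline{\mathrm{id}_X}\colon\mathcal F(X)\to X$, i.e. $\beta_X(\delta(x))=x$. $X$ has the lifting property if there is a bounded linear $T\colon X\to\mathcal F(X)$ with $\beta_XT=\mathrm{Id}_X$ (a bounded linear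 right inverse of $\beta_X$). An automorphism of $X$ is a bounded linear bijection of $X$ with bounded inverse. For an automorphism $g$ of $X$, $\tilde g\colon\mathcal F(X)\to\mathcal F(X)$ is the induced automorphism determined by $\tilde g\,\delta(x)=\delta(gx)$. A group $G$ of automorphisms is bounded if $\sup_{g\in G}\|g\|<\infty$. A map $T\colon X\to\mathcal F(X)$ is $G$-equivariant if $Tg=\tilde gT$ for all $g\in G$. *)

theory Defs
  imports "HOL-Analysis.Analysis"
begin

section \<open>The space of Lipschitz functions vanishing at the base point\<close>

text \<open>The base point of the metric space is the element \<open>0\<close>; for a normed space it is the origin.\<close>

typedef (overloaded) 'a lip0 =
  "{f :: 'a::{metric_space, zero} \<Rightarrow> real. f 0 = 0 \<and> (\<exists>C. C-lipschitz_on UNIV f)}"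
  morphisms lip0_apply Abs_lip0
  by (rule exI[of _ "\<lambda>_. 0"]) (auto intro: lipschitz_on_constant)

setup_lifting type_definition_lip0

lemma lip0_apply_zero [simp]: "lip0_apply f 0 = 0"
  by transfer simp

lemma lip0_lipschitz: "\<exists>C. C-lipschitz_on UNIV (lip0_apply f)"
  by transfer simp

lemma lip0_eqI: "f = g" if "\<And>x. lip0_apply f x = lip0_apply g x"
  using that by (intro iffD1[OF lip0_apply_inject] ext)

instantiation lip0 :: ("{metric_space, zero}") real_vector
begin

lift_definition zero_lip0 :: "'a lip0" is "\<lambda>_. 0"
  by (auto intro: lipschitz_on_constant)

lift_definition plus_lip0 :: "'a lip0 \<Rightarrow> 'a lip0 \<Rightarrow> 'a lip0" is "\<lambda>f g x. f x + g x"
  by (elim CollectE conjE exE, intro CollectI conjI exI, simp, rule lipschitz_on_add)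

lift_definition uminus_lip0 :: "'a lip0 \<Rightarrow> 'a lip0" is "\<lambda>f x. - f x"
  by auto

lift_definition minus_lip0 :: "'a lip0 \<Rightarrow> 'a lip0 \<Rightarrow> 'a lip0" is "\<lambda>f g x. f x - g x"
  by (elim CollectE conjE exE, intro CollectI conjI exI, simp, rule lipschitz_on_diff)

lift_definition scaleR_lip0 :: "real \<Rightarrow> 'a lip0 \<Rightarrow> 'a lip0" is "\<lambda>c f x. c *\<^sub>R f x"
  by (elim CollectE conjE exE, intro CollectI conjI exI, simp, rule lipschitz_on_cmult)

lemmas lip0_rep_eqs = zero_lip0.rep_eq plus_lip0.rep_eq uminus_lip0.rep_eq minus_lip0.rep_eq
  scaleR_lip0.rep_eq

instance
proof
  fix a b :: real and f g h :: "'a lip0"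
  show "f + g + h = f + (g + h)" by (rule lip0_eqI) (simp add: lip0_rep_eqs)
  show "f + g = g + f" by (rule lip0_eqI) (simp add: lip0_rep_eqs)
  show "0 + f = f" by (rule lip0_eqI) (simp add: lip0_rep_eqs)
  show "- f + f = 0" by (rule lip0_eqI) (simp add: lip0_rep_eqs)
  show "f - g = f + - g" by (rule lip0_eqI) (simp add: lip0_rep_eqs)
  show "a *\<^sub>R (f + g) = a *\<^sub>R f + a *\<^sub>R g"
    by (rule lip0_eqI) (simp add: lip0_rep_eqs distrib_left)
  show "(a + b) *\<^sub>R f = a *\<^sub>R f + b *\<^sub>R f"
    by (rule lip0_eqI) (simp add: lip0_rep_eqs distrib_right)
  show "a *\<^sub>R b *\<^sub>R f = (a * b) *\<^sub>R f" by (rule lip0_eqI) (simp add: lip0_rep_eqs)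
  show "1 *\<^sub>R f = f" by (rule lip0_eqI) (simp add: lip0_rep_eqs)
qed

end

instantiation lip0 :: ("{metric_space, zero}") real_normed_vector
begin

definition norm_lip0 :: "'a lip0 \<Rightarrow> real" where
  "norm_lip0 f = Inf {C. C-lipschitz_on UNIV (lip0_apply f)}"

definition dist_lip0 :: "'a lip0 \<Rightarrow> 'a lip0 \<Rightarrow> real" where
  "dist_lip0 f g = norm (f - g)"

definition sgn_lip0 :: "'a lip0 \<Rightarrow> 'a lip0" where
  "sgn_lip0 f = f /\<^sub>R norm f"

definition uniformity_lip0 :: "('a lip0 \<times> 'a lip0) filter" where
  "uniformity_lip0 = (INF e\<in>{0 <..}. principal {(f, g). dist f g < e})"

definition open_lip0 :: "'a lip0 set \<Rightarrow> bool" where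
  "open_lip0 S = (\<forall>f\<in>S. \<forall>\<^sub>F (f', g) in uniformity. f' = f \<longrightarrow> g \<in> S)"

lemma norm_lip0_lower: "norm f \<le> C" if "C-lipschitz_on UNIV (lip0_apply f)"
  unfolding norm_lip0_def
  by (rule cInf_lower) (use that in \<open>auto simp: lipschitz_on_def intro: bdd_belowI[of _ 0]\<close>)

lemma norm_lip0_lipschitz: "(norm f)-lipschitz_on UNIV (lip0_apply f)"
proof (rule lipschitz_onI)
  let ?S = "{C. C-lipschitz_on UNIV (lip0_apply f)}"
  have ne: "?S \<noteq> {}"
    using lip0_lipschitz by blast
  show "0 \<le> norm f"
    unfolding norm_lip0_def using ne by (rule cInf_greatest) (simp add: lipschitz_on_def)
  fix x y
  show "dist (lip0_apply f x) (lip0_apply f y) \<le> norm f * dist x y"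
  proof (cases "x = y")
    case False
    then have pos: "dist x y > 0" by simp
    have "dist (lip0_apply f x) (lip0_apply f y) / dist x y \<le> norm f"
      unfolding norm_lip0_def using ne
    proof (rule cInf_greatest)
      fix C
      assume "C \<in> ?S"
      then have "dist (lip0_apply f x) (lip0_apply f y) \<le> C * dist x y"
        by (simp add: lipschitz_on_def)
      with pos show "dist (lip0_apply f x) (lip0_apply f y) / dist x y \<le> C"
        by (simp add: divide_le_eq)
    qed
    then show ?thesis using pos by (simp add: divide_le_eq)
  qed simp
qed

instance
proof
  fix f g :: "'a lip0" and a :: real
  have lip: "(norm h)-lipschitz_on UNIV (lip0_apply h)" for h :: "'a lip0"
    by (rule norm_lip0_lipschitz)
  show "norm f = 0 \<longleftrightarrow> f = 0"
  proof
    assume "norm f = 0"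
    then have "lip0_apply f x = 0" for x
      using lipschitz_onD[OF lip[of f] UNIV_I UNIV_I, of x 0] by simp
    then show "f = 0"
      by (simp add: lip0_apply_inject[symmetric] zero_lip0.rep_eq fun_eq_iff)
  next
    assume "f = 0"
    then have "0-lipschitz_on UNIV (lip0_apply f)"
      by (simp add: zero_lip0.rep_eq lipschitz_on_constant)
    then show "norm f = 0"
      by (rule antisym[OF norm_lip0_lower lipschitz_on_nonneg[OF lip]])
  qed
  show "norm (f + g) \<le> norm f + norm g"
    using lipschitz_on_add[OF lip[of f] lip[of g]]
    by (intro norm_lip0_lower) (simp only: plus_lip0.rep_eq)
  have le: "norm (c *\<^sub>R h) \<le> \<bar>c\<bar> * norm h" for c and h :: "'a lip0"
    using lipschitz_on_cmult[OF lip[of h], of c]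
    by (intro norm_lip0_lower) (simp only: scaleR_lip0.rep_eq)
  show "norm (a *\<^sub>R f) = \<bar>a\<bar> * norm f"
  proof (cases "a = 0")
    case True
    then show ?thesis
      using le[of 0 f] lipschitz_on_nonneg[OF lip[of "a *\<^sub>R f"]] by simp
  next
    case False
    have "norm f \<le> \<bar>inverse a\<bar> * norm (a *\<^sub>R f)"
      using le[of "inverse a" "a *\<^sub>R f"] False by simp
    then have "\<bar>a\<bar> * norm f \<le> norm (a *\<^sub>R f)"
      using False by (simp add: field_simps)
    with le[of a f] show ?thesis by simp
  qed
qed (rule dist_lip0_def sgn_lip0_def uniformity_lip0_def open_lip0_def)+

end


section \<open>The Lipschitz-free space\<close>

lemma lip0_apply_bounded_linear:
  "bounded_linear (\<lambda>f. lip0_apply f (x :: 'a::{metric_space, zero}))"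
proof (rule bounded_linear_intro)
  fix f :: "'a lip0"
  show "norm (lip0_apply f x) \<le> norm f * dist x 0"
    using lipschitz_onD[OF norm_lip0_lipschitz[of f], of x 0] by simp
qed (simp_all add: plus_lip0.rep_eq scaleR_lip0.rep_eq)

lift_definition evaluation :: "'a::{metric_space, zero} \<Rightarrow> 'a lip0 \<Rightarrow>\<^sub>L real"
  is "\<lambda>x f. lip0_apply f x"
  by (rule lip0_apply_bounded_linear)

typedef (overloaded) 'a free_space =
  "closure (span (range (evaluation :: 'a::{metric_space, zero} \<Rightarrow> 'a lip0 \<Rightarrow>\<^sub>L real)))"
  morphisms free_functional Abs_free_space
  by (rule exI[of _ 0]) (auto intro: set_mp[OF closure_subset] span_zero)

setup_lifting type_definition_free_space

lift_definition delta :: "'a::{metric_space, zero} \<Rightarrow> 'a free_space" is evaluation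
  by (auto intro: set_mp[OF closure_subset] span_base)

lemma closure_span_add:
  fixes S :: "'b::real_normed_vector set"
  assumes "x \<in> closure (span S)" "y \<in> closure (span S)"
  shows "x + y \<in> closure (span S)"
proof -
  obtain u v where "\<forall>n. u n \<in> span S" "u \<longlonglongrightarrow> x" "\<forall>n. v n \<in> span S" "v \<longlonglongrightarrow> y"
    using assms unfolding closure_sequential by blast
  then show ?thesis
    unfolding closure_sequential
    by (intro exI[of _ "\<lambda>n. u n + v n"]) (auto intro: tendsto_add span_add)
qed

lemma closure_span_scale:
  fixes S :: "'b::real_normed_vector set"
  assumes "x \<in> closure (span S)"
  shows "c *\<^sub>R x \<in> closure (span S)"
proof -
  obtain u where "\<forall>n. u n \<in> span S" "u \<longlonglongrightarrow> x"
    using assms unfolding closure_sequential by blast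
  then show ?thesis
    unfolding closure_sequential
    by (intro exI[of _ "\<lambda>n. c *\<^sub>R u n"]) (auto intro: tendsto_scaleR span_scale)
qed

instantiation free_space :: ("{metric_space, zero}") real_vector
begin

lift_definition zero_free_space :: "'a free_space" is 0
  by (auto intro: set_mp[OF closure_subset] span_zero)

lift_definition plus_free_space :: "'a free_space \<Rightarrow> 'a free_space \<Rightarrow> 'a free_space" is "(+)"
  by (rule closure_span_add)

lift_definition uminus_free_space :: "'a free_space \<Rightarrow> 'a free_space" is uminus
  using closure_span_scale[of _ _ "-1"] by simp

lift_definition minus_free_space :: "'a free_space \<Rightarrow> 'a free_space \<Rightarrow> 'a free_space" is "(-)"
  subgoal for x y
    using closure_span_add[of x _ "- y"] closure_span_scale[of y _ "-1"] by simp
  done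

lift_definition scaleR_free_space :: "real \<Rightarrow> 'a free_space \<Rightarrow> 'a free_space" is "(*\<^sub>R)"
  by (rule closure_span_scale)

lemmas free_space_rep_eqs = zero_free_space.rep_eq plus_free_space.rep_eq
  uminus_free_space.rep_eq minus_free_space.rep_eq scaleR_free_space.rep_eq

instance
proof
  fix a b :: real and l m n :: "'a free_space"
  show "l + m + n = l + (m + n)" by (intro iffD1[OF free_functional_inject]) (simp only: free_space_rep_eqs add.assoc)
  show "l + m = m + l" by (intro iffD1[OF free_functional_inject]) (simp only: free_space_rep_eqs add.commute)
  show "0 + l = l" by (intro iffD1[OF free_functional_inject]) (simp only: free_space_rep_eqs add_0)
  show "- l + l = 0" by (intro iffD1[OF free_functional_inject]) (simp only: free_space_rep_eqs left_minus)
  show "l - m = l + - m" by (intro iffD1[OF free_functional_inject]) (simp only: free_space_rep_eqs diff_conv_add_uminus)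
  show "a *\<^sub>R (l + m) = a *\<^sub>R l + a *\<^sub>R m"
    by (intro iffD1[OF free_functional_inject]) (simp only: free_space_rep_eqs scaleR_add_right)
  show "(a + b) *\<^sub>R l = a *\<^sub>R l + b *\<^sub>R l"
    by (intro iffD1[OF free_functional_inject]) (simp only: free_space_rep_eqs scaleR_add_left)
  show "a *\<^sub>R b *\<^sub>R l = (a * b) *\<^sub>R l" by (intro iffD1[OF free_functional_inject]) (simp only: free_space_rep_eqs scaleR_scaleR)
  show "1 *\<^sub>R l = l" by (intro iffD1[OF free_functional_inject]) (simp only: free_space_rep_eqs scaleR_one)
qed

end

instantiation free_space :: ("{metric_space, zero}") real_normed_vector
begin

lift_definition norm_free_space :: "'a free_space \<Rightarrow> real" is norm .

definition dist_free_space :: "'a free_space \<Rightarrow> 'a free_space \<Rightarrow> real" where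
  "dist_free_space m n = norm (m - n)"

definition sgn_free_space :: "'a free_space \<Rightarrow> 'a free_space" where
  "sgn_free_space m = m /\<^sub>R norm m"

definition uniformity_free_space :: "('a free_space \<times> 'a free_space) filter" where
  "uniformity_free_space = (INF e\<in>{0 <..}. principal {(m, n). dist m n < e})"

definition open_free_space :: "'a free_space set \<Rightarrow> bool" where
  "open_free_space S = (\<forall>m\<in>S. \<forall>\<^sub>F (m', n) in uniformity. m' = m \<longrightarrow> n \<in> S)"

instance
proof
  fix m n :: "'a free_space" and a :: real
  show "norm m = 0 \<longleftrightarrow> m = 0" by transfer simp
  show "norm (m + n) \<le> norm m + norm n" by transfer (rule norm_triangle_ineq)
  show "norm (a *\<^sub>R m) = \<bar>a\<bar> * norm m" by transfer simp
qed (rule dist_free_space_def sgn_free_space_def uniformity_free_space_def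
      open_free_space_def)+

end

lemma dist_free_functional: "dist (free_functional m) (free_functional n) = dist m n"
  by (simp add: dist_free_space_def dist_norm norm_free_space.rep_eq minus_free_space.rep_eq)

instance free_space :: ("{metric_space, zero}") banach
proof
  fix X :: "nat \<Rightarrow> 'a free_space"
  assume "Cauchy X"
  then have "Cauchy (\<lambda>n. free_functional (X n))"
    by (simp only: Cauchy_def dist_free_functional)
  then obtain l where l: "(\<lambda>n. free_functional (X n)) \<longlonglongrightarrow> l"
    using Cauchy_convergent_iff convergent_def by blast
  have "l \<in> closure (span (range evaluation))"
    by (rule closed_sequentially[OF closed_closure free_functional l])
  then obtain m where "l = free_functional m"
    by (rule free_functional_cases)
  with l have "X \<longlonglongrightarrow> m"
    by (simp only: tendsto_iff dist_free_functional)
  then show "convergent X"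
    by (auto simp: convergent_def)
qed

text \<open>
  The bounded linear extension to the free space of a Lipschitz map \<open>L\<close> with \<open>L 0 = 0\<close>
  and values in a Banach space. It is uniquely determined by its values on the points \<open>delta x\<close>;
  for other \<open>L\<close> the value is irrelevant.
\<close>

definition linear_extension ::
    "('a::{metric_space, zero} \<Rightarrow> 'b::real_normed_vector) \<Rightarrow> 'a free_space \<Rightarrow>\<^sub>L 'b" where
  "linear_extension L = (THE F. \<forall>x. blinfun_apply F (delta x) = L x)"

definition barycenter :: "'a::real_normed_vector free_space \<Rightarrow>\<^sub>L 'a" where
  "barycenter = linear_extension (\<lambda>x. x)"

definition induced_map ::
    "('a::real_normed_vector \<Rightarrow>\<^sub>L 'a) \<Rightarrow> 'a free_space \<Rightarrow>\<^sub>L 'a free_space" where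
  "induced_map g = linear_extension (\<lambda>x. delta (blinfun_apply g x))"

definition barycenter_right_inverse :: "('a::real_normed_vector \<Rightarrow> 'a free_space) \<Rightarrow> bool" where
  "barycenter_right_inverse T \<longleftrightarrow> bounded_linear T \<and> (\<forall>x. barycenter (T x) = x)"

definition lifting_property :: "'a::banach itself \<Rightarrow> bool" where
  "lifting_property _ \<longleftrightarrow> (\<exists>T :: 'a \<Rightarrow> 'a free_space. barycenter_right_inverse T)"


section \<open>Groups of automorphisms\<close>

definition automorphism :: "('a::real_normed_vector \<Rightarrow>\<^sub>L 'a) \<Rightarrow> bool" where
  "automorphism g \<longleftrightarrow> bij (blinfun_apply g) \<and> bounded_linear (inv (blinfun_apply g))"

definition automorphism_group :: "('a::real_normed_vector \<Rightarrow>\<^sub>L 'a) set \<Rightarrow> bool" where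
  "automorphism_group G \<longleftrightarrow>
     (\<forall>g\<in>G. automorphism g) \<and>
     id_blinfun \<in> G \<and>
     (\<forall>g\<in>G. \<forall>h\<in>G. g o\<^sub>L h \<in> G) \<and>
     (\<forall>g\<in>G. Blinfun (inv (blinfun_apply g)) \<in> G)"

definition equivariant ::
    "('a::real_normed_vector \<Rightarrow>\<^sub>L 'a) set \<Rightarrow> ('a \<Rightarrow> 'a free_space) \<Rightarrow> bool" where
  "equivariant G T \<longleftrightarrow> (\<forall>g\<in>G. \<forall>x. T (blinfun_apply g x) = induced_map g (T x))"


section \<open>Normalized Haar measure\<close>

text \<open>
  A left-invariant Radon probability measure on the Borel sets of a compact Hausdorff group, given
  by its topology and multiplication. Since the group need not be metrizable, regularity has to be
  required explicitly.
\<close>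

definition normalized_haar_measure ::
    "'g topology \<Rightarrow> ('g \<Rightarrow> 'g \<Rightarrow> 'g) \<Rightarrow> 'g measure \<Rightarrow> bool" where
  "normalized_haar_measure \<tau> gmult \<mu> \<longleftrightarrow>
     space \<mu> = topspace \<tau> \<and>
     sets \<mu> = sigma_sets (topspace \<tau>) {U. openin \<tau> U} \<and>
     emeasure \<mu> (topspace \<tau>) = 1 \<and>
     (\<forall>g\<in>topspace \<tau>. \<forall>A\<in>sets \<mu>. emeasure \<mu> (gmult g ` A) = emeasure \<mu> A) \<and>
     (\<forall>A\<in>sets \<mu>. emeasure \<mu> A = (INF U\<in>{U. openin \<tau> U \<and> A \<subseteq> U}. emeasure \<mu> U)) \<and>
     (\<forall>U. openin \<tau> U \<longrightarrow>
        emeasure \<mu> U = (SUP K\<in>{K. compactin \<tau> K \<and> K \<subseteq> U}. emeasure \<mu> K))"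


section \<open>The Bochner integral without separability of the target space\<close>

text \<open>
  \<^const>\<open>has_bochner_integral\<close> is only available for second countable target types. The definitions
  below are those of the library with that sort constraint removed. Approximability in mean by
  simple functions makes the integrand almost everywhere separably valued, so that together with
  Borel measurability it is strongly measurable.
\<close>

definition has_bochner_integral_in ::
    "'a measure \<Rightarrow> ('a \<Rightarrow> 'b::real_normed_vector) \<Rightarrow> 'b \<Rightarrow> bool" where
  "has_bochner_integral_in M f x \<longleftrightarrow>
     f \<in> borel_measurable M \<and>
     (\<exists>s. (\<forall>i. Bochner_Integration.simple_bochner_integrable M (s i)) \<and>
          (\<lambda>i. \<integral>\<^sup>+ y. ennreal (norm (f y - s i y)) \<partial>M) \<longlonglongrightarrow> 0 \<and>
          (\<lambda>i. Bochner_Integration.simple_bochner_integral M (s i)) \<longlonglongrightarrow> x)"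

lemma has_bochner_integral_in_iff:
  fixes f :: "'a \<Rightarrow> 'b::{real_normed_vector, second_countable_topology}"
  shows "has_bochner_integral_in M f x \<longleftrightarrow> has_bochner_integral M f x"
  unfolding has_bochner_integral_in_def has_bochner_integral.simps by simp

definition bochner_integrable :: "'a measure \<Rightarrow> ('a \<Rightarrow> 'b::real_normed_vector) \<Rightarrow> bool" where
  "bochner_integrable M f \<longleftrightarrow> (\<exists>x. has_bochner_integral_in M f x)"

definition bochner_integral :: "'a measure \<Rightarrow> ('a \<Rightarrow> 'b::real_normed_vector) \<Rightarrow> 'b" where
  "bochner_integral M f =
     (if bochner_integrable M f then THE x. has_bochner_integral_in M f x else 0)"

end

theory Submission
  imports Defs
begin

text \<open>
  Everything is tested against the Lipschitz functions \<open>f\<close> vanishing at \<open>0\<close>, which separate the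
  points of the free space and commute with the Bochner integral. The integrand is continuous for
  the strong operator topology since \<open>G\<close> is bounded, so its range is compact and the integral
  exists. Linearity and the norm bound for \<open>T\<close> are then inherited from real integrals;
  equivariance is left invariance of \<open>\<mu>\<close> under the substitution \<open>g = h k\<close>. A functional
  \<open>\<phi>\<close> on \<open>'a\<close> is itself such an \<open>f\<close> and
  \<open>\<phi> (barycenter m) = free_functional m \<phi>\<close>, so that the integrand of \<open>\<phi> (barycenter (T x))\<close> is
  constantly \<open>\<phi> x\<close>; the Hahn-Banach theorem concludes.
\<close>

section \<open>The Hahn-Banach theorem\<close>

text \<open>Homogeneity is required only as an inequality and only for positive \<open>c\<close>:
  this passes to infima directly, and \<open>sublinear_scale\<close> recovers the equality by
  applying it to \<open>inverse c\<close>.\<close>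

definition sublinear :: "('a::real_vector \<Rightarrow> real) \<Rightarrow> bool" where
  "sublinear p \<longleftrightarrow> (\<forall>x y. p (x + y) \<le> p x + p y) \<and> (\<forall>c>0. \<forall>x. p (c *\<^sub>R x) \<le> c * p x)"

lemma sublinear_add: "sublinear p \<Longrightarrow> p (x + y) \<le> p x + p y"
  by (simp add: sublinear_def)

lemma sublinear_scale_le: "sublinear p \<Longrightarrow> c > 0 \<Longrightarrow> p (c *\<^sub>R x) \<le> c * p x"
  by (simp add: sublinear_def)

lemma sublinear_zero:
  assumes "sublinear p" shows "p 0 = 0"
  \<comment> \<open>The factor 2 yields \<open>0 \<le> p 0\<close>, the factor 1/2 yields
    \<open>p 0 \<le> 0\<close>.\<close>
  using sublinear_scale_le[OF assms, of 2 0] sublinear_scale_le[OF assms, of "1/2" 0] by simp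

lemma sublinear_scale:
  assumes "sublinear p" "c \<ge> 0" shows "p (c *\<^sub>R x) = c * p x"
proof (cases "c = 0")
  case False
  with assms have "c > 0" by simp
  then have "p x \<le> inverse c * p (c *\<^sub>R x)"
    using sublinear_scale_le[OF assms(1), of "inverse c" "c *\<^sub>R x"] by simp
  with \<open>c > 0\<close> sublinear_scale_le[OF assms(1) \<open>c > 0\<close>, of x] show ?thesis
    by (simp add: field_simps)
qed (simp add: sublinear_zero[OF assms(1)])

lemma sublinear_uminus_ge:
  assumes "sublinear p" shows "- p (- x) \<le> p x"
  using sublinear_add[OF assms, of x "- x"] sublinear_zero[OF assms] by simp

lemma sublinear_norm: "sublinear (norm :: 'a::real_normed_vector \<Rightarrow> real)"
  by (simp add: sublinear_def norm_triangle_ineq)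

text \<open>The infimum of \<open>p\<close> along the ray from \<open>x\<close> in direction
  \<open>y\<close>, corrected by \<open>t * p y\<close>, does it: \<open>t = 0\<close> gives
  \<open>q \<le> p\<close>, and \<open>t = 1\<close> at \<open>- y\<close> gives the last
  inequality. It serves twice, to show that minimal sublinear functionals are odd and to prescribe a
  value of a functional below the norm.\<close>

lemma sublinear_lower:
  assumes p: "sublinear p"
  obtains q where "sublinear q" "\<And>x. q x \<le> p x" "q (- y) \<le> - p y"
proof
  define q where "q x = (INF t\<in>{0..}. p (x + t *\<^sub>R y) - t * p y)" for x
  have bdd: "bdd_below ((\<lambda>t. p (x + t *\<^sub>R y) - t * p y) ` {0..})" for x
  proof (rule bdd_belowI2)
    fix t :: real assume "t \<in> {0..}"
    \<comment> \<open>Subadditivity applied to \<open>t y = (x + t y) + (- x)\<close> keeps the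
      infimum finite.\<close>
    then show "- p (- x) \<le> p (x + t *\<^sub>R y) - t * p y"
      using sublinear_add[OF p, of "x + t *\<^sub>R y" "- x"] sublinear_scale[OF p, of t y] by simp
  qed
  have q_le: "q x \<le> p (x + t *\<^sub>R y) - t * p y" if "t \<ge> 0" for x t
    unfolding q_def using that by (intro cINF_lower[OF bdd]) simp
  have q_ge: "a \<le> q x" if "\<And>t. t \<ge> 0 \<Longrightarrow> a \<le> p (x + t *\<^sub>R y) - t * p y" for a x
    unfolding q_def using that by (intro cINF_greatest) auto
  show "sublinear q"
    unfolding sublinear_def
  proof (intro conjI allI impI)
    fix x z
    \<comment> \<open>Parameters \<open>t\<close> for \<open>x\<close> and \<open>s\<close> for
      \<open>z\<close> add up to an admissible parameter for \<open>x + z\<close>. The infima are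
      taken one after the other, first over \<open>s\<close>, then over \<open>t\<close>.\<close>
    have "q (x + z) - (p (x + t *\<^sub>R y) - t * p y) \<le> q z" if t: "t \<ge> 0" for t
    proof (rule q_ge)
      fix s :: real assume s: "s \<ge> 0"
      have "q (x + z) \<le> p ((x + t *\<^sub>R y) + (z + s *\<^sub>R y)) - (t + s) * p y"
        using q_le[of "t + s" "x + z"] t s by (simp add: algebra_simps)
      with sublinear_add[OF p, of "x + t *\<^sub>R y" "z + s *\<^sub>R y"]
      show "q (x + z) - (p (x + t *\<^sub>R y) - t * p y) \<le> p (z + s *\<^sub>R y) - s * p y"
        by (simp add: algebra_simps)
    qed
    then have "q (x + z) - q z \<le> q x"
      by (intro q_ge) (simp add: algebra_simps)
    then show "q (x + z) \<le> q x + q z" by simp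
  next
    fix c :: real and x assume c: "c > 0"
    have "q (c *\<^sub>R x) / c \<le> q x"
    proof (rule q_ge)
      fix t :: real assume t: "t \<ge> 0"
      have "q (c *\<^sub>R x) \<le> p (c *\<^sub>R (x + t *\<^sub>R y)) - (c * t) * p y"
        using q_le[of "c * t" "c *\<^sub>R x"] c t by (simp add: algebra_simps)
      also have "p (c *\<^sub>R (x + t *\<^sub>R y)) = c * p (x + t *\<^sub>R y)"
        using c by (intro sublinear_scale[OF p]) simp
      finally show "q (c *\<^sub>R x) / c \<le> p (x + t *\<^sub>R y) - t * p y"
        using c by (simp add: field_simps)
    qed
    then show "q (c *\<^sub>R x) \<le> c * q x" using c by (simp add: field_simps)
  qed
  show "q x \<le> p x" for x using q_le[of 0 x] by simp
  show "q (- y) \<le> - p y" using q_le[of 1 "- y"] by (simp add: sublinear_zero[OF p])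
qed

text \<open>The pointwise infimum is finite because every \<open>q\<close> in the chain satisfies
  \<open>q x \<ge> - q (- x) \<ge> - p (- x)\<close>. It is subadditive because of two members
  \<open>q\<close> and \<open>r\<close> the smaller one can be used at both points, which is where
  comparability enters.\<close>

lemma sublinear_chain_lower_bound:
  assumes p: "sublinear p" and C: "C \<subseteq> {q. sublinear q \<and> q \<le> p}" "C \<noteq> {}"
    and chain: "\<And>q r. q \<in> C \<Longrightarrow> r \<in> C \<Longrightarrow> q \<le> r \<or> r \<le> q"
  obtains m where "sublinear m" "\<And>q. q \<in> C \<Longrightarrow> m \<le> q"
proof
  define m where "m x = (INF q\<in>C. q x)" for x
  have bdd: "bdd_below ((\<lambda>q. q x) ` C)" for x
  proof (rule bdd_belowI2)
    fix q assume "q \<in> C"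
    with C have "sublinear q" "q (- x) \<le> p (- x)" by (auto simp: le_fun_def)
    then show "- p (- x) \<le> q x" using sublinear_uminus_ge[of q x] by simp
  qed
  have m_le: "m x \<le> q x" if "q \<in> C" for x q
    unfolding m_def using that by (intro cINF_lower[OF bdd])
  have m_ge: "a \<le> m x" if "\<And>q. q \<in> C \<Longrightarrow> a \<le> q x" for a x
    unfolding m_def using that C(2) by (intro cINF_greatest) auto
  show "m \<le> q" if "q \<in> C" for q using m_le[OF that] by (simp add: le_fun_def)
  show "sublinear m"
    unfolding sublinear_def
  proof (intro conjI allI impI)
    fix x y
    have "m (x + y) - q x \<le> m y" if q: "q \<in> C" for q
    proof (rule m_ge)
      fix r assume r: "r \<in> C"
      consider "q \<le> r" | "r \<le> q" using chain[OF q r] by blast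
      then show "m (x + y) - q x \<le> r y"
      proof cases
        case 1
        moreover have "m (x + y) \<le> q x + q y"
          using m_le[OF q, of "x + y"] sublinear_add[of q x y] q C by fastforce
        ultimately show ?thesis by (simp add: le_fun_def) (smt (verit))
      next
        case 2
        moreover have "m (x + y) \<le> r x + r y"
          using m_le[OF r, of "x + y"] sublinear_add[of r x y] r C by fastforce
        ultimately show ?thesis by (simp add: le_fun_def) (smt (verit))
      qed
    qed
    then have "m (x + y) - m y \<le> m x" by (intro m_ge) (simp add: algebra_simps)
    then show "m (x + y) \<le> m x + m y" by simp
  next
    fix c :: real and x assume c: "c > 0"
    have "m (c *\<^sub>R x) / c \<le> m x"
    proof (rule m_ge)
      fix q assume q: "q \<in> C"
      then have "m (c *\<^sub>R x) \<le> c * q x"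
        using m_le[OF q, of "c *\<^sub>R x"] sublinear_scale_le[of q c x] c C by fastforce
      then show "m (c *\<^sub>R x) / c \<le> q x" using c by (simp add: field_simps)
    qed
    then show "m (c *\<^sub>R x) \<le> c * m x" using c by (simp add: field_simps)
  qed
qed

text \<open>
  A minimal element among the sublinear functionals is additive, because \<open>sublinear_lower\<close> cannot
  decrease it any further.
\<close>

theorem hahn_banach_sublinear:
  assumes p: "sublinear p"
  obtains f where "linear f" "\<And>x. f x \<le> p x"
proof -
  let ?A = "{q. sublinear q \<and> q \<le> p}"
  have po: "partial_order_on ?A (relation_of (\<ge>) ?A)"
    by (rule partial_order_on_relation_ofI) auto
  \<comment> \<open>The order is reversed, so that the maximal element supplied by Zorn's lemma is a
    minimal sublinear functional.\<close>
  have "\<exists>m\<in>?A. \<forall>q\<in>?A. m \<ge> q \<longrightarrow> q = m"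
  proof (rule predicate_Zorn[OF po])
    fix C assume C: "C \<in> Chains (relation_of (\<ge>) ?A)"
    then have sub: "C \<subseteq> ?A" and chain: "\<And>q r. q \<in> C \<Longrightarrow> r \<in> C \<Longrightarrow> q \<le> r \<or> r \<le> q"
      by (auto simp: Chains_def relation_of_def)
    show "\<exists>u\<in>?A. \<forall>a\<in>C. u \<le> a"
    proof (cases "C = {}")
      case True
      with p show ?thesis by auto
    next
      case False
      obtain m where m: "sublinear m" "\<And>q. q \<in> C \<Longrightarrow> m \<le> q"
        using sublinear_chain_lower_bound[OF p sub False chain] by blast
      from False sub m(2) have "m \<le> p" by (blast intro: order_trans)
      with m show ?thesis by auto
    qed
  qed
  then obtain m where m: "sublinear m" "m \<le> p"
    and minimal: "\<And>q. sublinear q \<Longrightarrow> q \<le> p \<Longrightarrow> q \<le> m \<Longrightarrow> q = m"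
    by blast
  have neg: "m (- y) = - m y" for y
  proof -
    obtain q where q: "sublinear q" "\<And>x. q x \<le> m x" "q (- y) \<le> - m y"
      using sublinear_lower[OF m(1)] by blast
    then have "q = m"
      using m(2) by (intro minimal) (auto simp: le_fun_def intro: order_trans)
    \<comment> \<open>Minimality turns \<open>q (- y) \<le> - m y\<close> into a bound on
      \<open>m (- y)\<close>; the opposite inequality holds for every sublinear functional.\<close>
    with q(3) sublinear_uminus_ge[OF m(1), of "- y"] show ?thesis by simp
  qed
  have "linear m"
  proof (rule linearI)
    \<comment> \<open>As \<open>m\<close> is odd, subadditivity at \<open>- x\<close> and
      \<open>- y\<close> is superadditivity at \<open>x\<close> and \<open>y\<close>.\<close>
    show "m (x + y) = m x + m y" for x y
      using sublinear_add[OF m(1), of x y] sublinear_add[OF m(1), of "- x" "- y"]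
        neg[of x] neg[of y] neg[of "x + y"] by simp
    show "m (c *\<^sub>R x) = c *\<^sub>R m x" for c x
    proof (cases "c \<ge> 0")
      case False
      then have "m ((- c) *\<^sub>R x) = - c * m x"
        by (intro sublinear_scale[OF m(1)]) simp
      with neg[of "c *\<^sub>R x"] show ?thesis by simp
    qed (simp add: sublinear_scale[OF m(1)])
  qed
  with m(2) that show ?thesis by (auto simp: le_fun_def)
qed

text \<open>The value at \<open>x\<close> is fixed by lowering the norm before a linear functional
  is chosen: any linear \<open>f \<le> q\<close> has \<open>f (- x) \<le> - norm x\<close>, hence
  \<open>f x \<ge> norm x\<close>, while \<open>f \<le> norm\<close> gives the converse and the norm
  bound. This takes the place of an extension from the line through \<open>x\<close>.\<close>

theorem hahn_banach_norming:
  fixes x :: "'a::real_normed_vector"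
  obtains f :: "'a \<Rightarrow>\<^sub>L real" where "norm f \<le> 1" "f x = norm x"
proof -
  obtain q where q: "sublinear q" "\<And>z. q z \<le> norm z" "q (- x) \<le> - norm x"
    using sublinear_lower[OF sublinear_norm, of x] by blast
  obtain f where f: "linear f" "\<And>z. f z \<le> q z"
    using hahn_banach_sublinear[OF q(1)] by blast
  have le: "f z \<le> norm z" for z using f(2)[of z] q(2)[of z] by simp
  have bound: "norm (f z) \<le> 1 * norm z" for z
    using le[of z] le[of "- z"] linear_neg[OF f(1), of z] by simp
  have "bounded_linear f"
    using f(1) bound by (intro bounded_linear_intro[of f 1]) (simp_all add: linear_add linear_scale)
  then have app: "blinfun_apply (Blinfun f) = f" by (rule bounded_linear_Blinfun_apply)
  show ?thesis
  proof (rule that)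
    show "norm (Blinfun f) \<le> 1" using bound by (intro norm_blinfun_bound) (simp_all add: app)
    show "blinfun_apply (Blinfun f) x = norm x"
      using f(2)[of "- x"] q(3) le[of x] linear_neg[OF f(1), of x] by (simp add: app)
  qed
qed

lemma blinfun_functionals_separate:
  fixes x y :: "'a::real_normed_vector"
  assumes "\<And>f :: 'a \<Rightarrow>\<^sub>L real. f x = f y"
  shows "x = y"
proof -
  obtain f :: "'a \<Rightarrow>\<^sub>L real" where "f (x - y) = norm (x - y)"
    using hahn_banach_norming[of "x - y"] by blast
  with assms[of f] show ?thesis by (simp add: blinfun.diff_right)
qed

section \<open>Bounded linear maps on the Lipschitz-free space\<close>

lemma bounded_linear_free_functional: "bounded_linear free_functional"
  by (rule bounded_linear_intro[where K = 1])
    (simp_all add: free_space_rep_eqs norm_free_space.rep_eq)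

lemma bounded_linear_free_functional_apply: "bounded_linear (\<lambda>m. free_functional m f)"
  by (rule bounded_linear_compose[OF blinfun.bounded_linear_left bounded_linear_free_functional])

lemma free_space_eqI:
  assumes "\<And>f. free_functional m f = free_functional n f"
  shows "m = n"
  using assms by (intro iffD1[OF free_functional_inject] blinfun_eqI)

lemma norm_free_space_le:
  assumes "0 \<le> C" "\<And>f. \<bar>free_functional m f\<bar> \<le> C * norm f"
  shows "norm m \<le> C"
  unfolding norm_free_space.rep_eq using assms by (intro norm_blinfun_bound) simp_all

lemma abs_free_functional_le: "\<bar>free_functional m f\<bar> \<le> norm m * norm f"
  using norm_blinfun[of "free_functional m" f] by (simp add: norm_free_space.rep_eq)

lemma free_functional_delta [simp]: "free_functional (delta x) f = lip0_apply f x"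
  by (simp add: delta.rep_eq evaluation.rep_eq)

lemma dist_delta_le: "dist (delta x) (delta y) \<le> dist x y"
  unfolding dist_norm[of "delta x"]
proof (rule norm_free_space_le)
  fix f
  show "\<bar>free_functional (delta x - delta y) f\<bar> \<le> dist x y * norm f"
    using lipschitz_onD[OF norm_lip0_lipschitz[of f], of x y]
    by (simp add: minus_free_space.rep_eq blinfun.diff_left dist_real_def mult.commute)
qed simp

text \<open>The span is built from 0 by adding multiples of point evaluations one at a time, and
  closedness covers the limits, which pull back from the dual space because
  \<open>free_functional\<close> is isometric. Identities, ranges and convergence thereby reduce to
  the points \<open>delta x\<close>.\<close>

lemma free_space_induct [case_names closed zero scale_add]:
  assumes closed: "closed {m. P m}" and zero: "P 0"
    and step: "\<And>c x m. P m \<Longrightarrow> P (c *\<^sub>R delta x + m)"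
  shows "P m"
proof -
  have span: "\<exists>m. free_functional m = u \<and> P m" if "u \<in> span (range evaluation)" for u
    using that
  proof (induction rule: span_induct_alt)
    case base
    then show ?case using zero zero_free_space.rep_eq by blast
  next
    case (step c e u)
    then obtain x m where "e = evaluation x" "free_functional m = u" "P m" by blast
    then show ?case
      using assms(3)[of m c x] by (intro exI[of _ "c *\<^sub>R delta x + m"])
        (simp add: free_space_rep_eqs delta.rep_eq)
  qed
  have "free_functional m \<in> closure (span (range evaluation))" by (rule free_functional)
  then obtain u where u: "\<And>n. u n \<in> span (range evaluation)" "u \<longlonglongrightarrow> free_functional m"
    unfolding closure_sequential by blast
  from span[OF u(1)] obtain v where v: "\<And>n. free_functional (v n) = u n" "\<And>n. P (v n)"
    by metis
  from u(2) have "(\<lambda>n. free_functional (v n)) \<longlonglongrightarrow> free_functional m"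
    by (simp add: v(1))
  then have lim: "v \<longlonglongrightarrow> m"
    by (simp only: tendsto_iff dist_free_functional)
  have "m \<in> {m. P m}"
    by (rule closed_sequentially[OF closed _ lim]) (simp add: v(2))
  then show ?thesis by simp
qed

text \<open>Continuous linear maps that agree on all \<open>delta x\<close> agree on the closed
  span, so any candidate with the right values settles the definite description.\<close>

lemma linear_extension_eqI:
  assumes F: "\<And>x. blinfun_apply F (delta x) = L x"
  shows "linear_extension L = F"
  unfolding linear_extension_def
proof (rule the_equality)
  fix H assume H: "\<forall>x. blinfun_apply H (delta x) = L x"
  have "H m = F m" for m
  proof (induction m rule: free_space_induct)
    case closed
    show ?case
      by (intro closed_Collect_eq continuous_intros)
  qed (use H F in \<open>simp_all add: blinfun.add_right blinfun.scaleR_right\<close>)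
  then show "H = F" by (rule blinfun_eqI)
qed (simp add: F)

text \<open>
  A Lipschitz map into \<open>'b\<close> extends linearly as soon as its composite with an isometric embedding
  does, since the image of the embedding is closed.
\<close>

lemma linear_extension_factor:
  fixes \<Phi> :: "'a::{metric_space, zero} free_space \<Rightarrow> 'c::real_normed_vector"
    and J :: "'b::banach \<Rightarrow> 'c"
  assumes \<Phi>: "bounded_linear \<Phi>" and J: "linear J" "\<And>y. norm (J y) = norm y"
    and L: "\<And>x. J (L x) = \<Phi> (delta x)"
  shows linear_extension_delta: "linear_extension L (delta x) = L x"
    and linear_extension_embed: "J (linear_extension L m) = \<Phi> m"
proof -
  interpret \<Phi>: bounded_linear \<Phi> by fact
  have J_bl: "bounded_linear J"
    using J by (intro bounded_linear_intro[of J 1]) (simp_all add: linear_add linear_scale)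
  then interpret J: bounded_linear J .
  have inj: "y = z" if "J y = J z" for y z
    using J(2)[of "y - z"] that by (simp add: J.diff)
  have "complete (range J)"
    by (rule complete_isometric_image[of 1]) (use J J_bl in \<open>simp_all add: complete_UNIV\<close>)
  then have "closed (range J)" by (rule complete_imp_closed)
  have "\<Phi> m \<in> range J" for m
  proof (induction m rule: free_space_induct)
    case closed
    show ?case
      using continuous_closed_vimage[OF \<open>closed (range J)\<close>, of \<Phi>]
      by (simp add: vimage_def linear_continuous_at[OF \<Phi>])
  next
    case zero
    show ?case by (metis J.zero \<Phi>.zero rangeI)
  next
    case (scale_add c x m)
    then obtain y where "\<Phi> m = J y" by blast
    then have "\<Phi> (c *\<^sub>R delta x + m) = J (c *\<^sub>R L x + y)"
      by (simp add: \<Phi>.add \<Phi>.scaleR J.add J.scaleR L)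
    then show ?case by blast
  qed
  note range = this
  \<comment> \<open>\<open>inv J\<close> merely chooses preimages. Since \<open>J\<close> is linear
    and injective the choice is forced, so \<open>F\<close> inherits linearity, and being norm
    preserving \<open>J\<close> transfers the bound on \<open>\<Phi>\<close>.\<close>
  define F where "F m = inv J (\<Phi> m)" for m
  have F: "J (F m) = \<Phi> m" for m
    unfolding F_def by (rule f_inv_into_f[OF range])
  obtain K where K: "\<And>m. norm (\<Phi> m) \<le> norm m * K" using \<Phi>.bounded by blast
  have "bounded_linear F"
  proof (rule bounded_linear_intro)
    show "norm (F m) \<le> norm m * K" for m
      using K[of m] J(2)[of "F m"] by (simp add: F)
  qed (auto intro!: inj simp: F J.add J.scaleR \<Phi>.add \<Phi>.scaleR)
  then have app: "blinfun_apply (Blinfun F) = F" by (rule bounded_linear_Blinfun_apply)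
  have FL: "F (delta x) = L x" for x by (rule inj) (simp add: F L)
  then have "linear_extension L = Blinfun F"
    by (intro linear_extension_eqI) (simp add: app)
  then show "linear_extension L (delta x) = L x" "J (linear_extension L m) = \<Phi> m"
    by (simp_all add: app FL F)
qed


section \<open>The barycenter map and induced automorphisms\<close>

lift_definition lip0_of_blinfun :: "('a::real_normed_vector \<Rightarrow>\<^sub>L real) \<Rightarrow> 'a lip0" is blinfun_apply
  by (auto simp: blinfun.zero_right intro: bounded_linear.lipschitz_boundE[OF blinfun.bounded_linear_right])

lemma lipschitz_on_blinfun: "(norm g)-lipschitz_on UNIV (blinfun_apply g)"
  by (rule lipschitz_onI)
    (use norm_blinfun[of g] in \<open>simp_all add: dist_norm blinfun.diff_right[symmetric]\<close>)

lemma bounded_linear_lip0_of_blinfun: "bounded_linear lip0_of_blinfun"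
proof (rule bounded_linear_intro[where K = 1])
  fix \<phi> :: "'a \<Rightarrow>\<^sub>L real"
  show "norm (lip0_of_blinfun \<phi>) \<le> norm \<phi> * 1"
    by (simp add: norm_lip0_lower lip0_of_blinfun.rep_eq lipschitz_on_blinfun)
qed (auto intro!: lip0_eqI simp: lip0_rep_eqs lip0_of_blinfun.rep_eq blinfun.add_left blinfun.scaleR_left)

lemma bounded_linear_blinfun_compose_left: "bounded_linear (\<lambda>u. u o\<^sub>L B)"
  by (rule bounded_bilinear.bounded_linear_left[OF bounded_bilinear_blinfun_compose])

text \<open>\<open>J\<close> is the canonical embedding into the bidual, isometric by
  \<open>hahn_banach_norming\<close>. Restricting \<open>free_functional m\<close> to the linear
  functionals is a bounded linear map that sends \<open>delta x\<close> to \<open>J x\<close>, so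
  \<open>linear_extension_embed\<close> applies to the identity map.\<close>

lemma blinfun_barycenter:
  "blinfun_apply \<phi> (barycenter m) = free_functional m (lip0_of_blinfun \<phi> :: 'a::banach lip0)"
proof -
  define J :: "'a \<Rightarrow> ('a \<Rightarrow>\<^sub>L real) \<Rightarrow>\<^sub>L real" where "J x = Blinfun (\<lambda>\<phi>. blinfun_apply \<phi> x)" for x
  define B :: "('a \<Rightarrow>\<^sub>L real) \<Rightarrow>\<^sub>L 'a lip0" where "B = Blinfun lip0_of_blinfun"
  have J: "J x \<phi> = \<phi> x" for x \<phi>
    unfolding J_def by (simp add: bounded_linear_Blinfun_apply[OF blinfun.bounded_linear_left])
  have B: "B \<phi> = lip0_of_blinfun \<phi>" for \<phi>
    unfolding B_def by (simp add: bounded_linear_Blinfun_apply[OF bounded_linear_lip0_of_blinfun])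
  have "linear J"
    by (rule linearI; rule blinfun_eqI)
      (simp_all add: J blinfun.add_left blinfun.add_right blinfun.scaleR_left blinfun.scaleR_right)
  moreover have "norm (J x) = norm x" for x
  proof (rule antisym)
    have "norm (J x \<phi>) \<le> norm x * norm \<phi>" for \<phi>
      using norm_blinfun[of \<phi> x] by (simp add: J mult.commute)
    then show "norm (J x) \<le> norm x"
      by (intro norm_blinfun_bound) simp_all
    obtain \<phi> :: "'a \<Rightarrow>\<^sub>L real" where \<phi>: "norm \<phi> \<le> 1" "\<phi> x = norm x" by (rule hahn_banach_norming)
    have "norm x \<le> norm (J x) * norm \<phi>"
      using norm_blinfun[of "J x" \<phi>] \<phi>(2) by (simp add: J)
    also have "\<dots> \<le> norm (J x)" using \<phi>(1) by (simp add: mult_left_le)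
    finally show "norm x \<le> norm (J x)" .
  qed
  moreover have "bounded_linear (\<lambda>m. free_functional m o\<^sub>L B)"
    by (rule bounded_linear_compose[OF bounded_linear_blinfun_compose_left bounded_linear_free_functional])
  moreover have "J x = free_functional (delta x) o\<^sub>L B" for x
    by (rule blinfun_eqI) (simp add: J B lip0_of_blinfun.rep_eq)
  ultimately show "blinfun_apply \<phi> (barycenter m) = free_functional m (lip0_of_blinfun \<phi>)"
    using linear_extension_embed[of "\<lambda>m. free_functional m o\<^sub>L B" J "\<lambda>x. x"] J[of "barycenter m" \<phi>]
    by (simp_all add: barycenter_def B)
qed

section \<open>Induced maps as adjoints of composition with a linear map\<close>

lift_definition lip0_comp :: "'a lip0 \<Rightarrow> ('a::real_normed_vector \<Rightarrow>\<^sub>L 'a) \<Rightarrow> 'a lip0"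
  is "\<lambda>f g x. f (blinfun_apply g x)"
  by (auto simp: blinfun.zero_right
      intro: lipschitz_on_compose2[OF lipschitz_on_blinfun lipschitz_on_subset[OF _ subset_UNIV]])

lemma norm_lip0_comp_le: "norm (lip0_comp f g) \<le> norm g * norm f"
proof -
  have "(norm f * norm g)-lipschitz_on UNIV (\<lambda>x. lip0_apply f (blinfun_apply g x))"
    by (rule lipschitz_on_compose2[OF lipschitz_on_blinfun
        lipschitz_on_subset[OF norm_lip0_lipschitz subset_UNIV]])
  then show ?thesis by (intro norm_lip0_lower) (simp add: lip0_comp.rep_eq mult.commute)
qed

lemma bounded_linear_lip0_comp: "bounded_linear (\<lambda>f. lip0_comp f g)"
proof (rule bounded_linear_intro)
  show "norm (lip0_comp f g) \<le> norm f * norm g" for f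
    using norm_lip0_comp_le[of f g] by (simp add: mult.commute)
qed (auto intro!: lip0_eqI simp: lip0_rep_eqs lip0_comp.rep_eq)

text \<open>The target is now itself a free space, and \<open>free_functional\<close> is its
  isometric embedding. The map on functionals is the adjoint of composition with \<open>g\<close>,
  which on \<open>delta x\<close> is evaluation at \<open>g x\<close>.\<close>

lemma
  shows induced_map_delta: "induced_map g (delta x) = delta (blinfun_apply g x)"
    and free_functional_induced_map:
      "free_functional (induced_map g m) f = free_functional m (lip0_comp f g)"
proof -
  define B where "B = Blinfun (\<lambda>f. lip0_comp f g)"
  have B: "B f = lip0_comp f g" for f
    unfolding B_def by (simp add: bounded_linear_Blinfun_apply[OF bounded_linear_lip0_comp])
  have "linear (free_functional :: 'a free_space \<Rightarrow> _)"
    by (rule bounded_linear.linear[OF bounded_linear_free_functional])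
  moreover have "norm (free_functional n) = norm n" for n :: "'a free_space"
    by (simp add: norm_free_space.rep_eq)
  moreover have "bounded_linear (\<lambda>m. free_functional m o\<^sub>L B)"
    by (rule bounded_linear_compose[OF bounded_linear_blinfun_compose_left bounded_linear_free_functional])
  moreover have "free_functional (delta (blinfun_apply g x)) = free_functional (delta x) o\<^sub>L B" for x
    by (rule blinfun_eqI) (simp add: B lip0_comp.rep_eq)
  ultimately show "induced_map g (delta x) = delta (blinfun_apply g x)"
    and "free_functional (induced_map g m) f = free_functional m (lip0_comp f g)"
    using linear_extension_factor[of "\<lambda>m. free_functional m o\<^sub>L B" free_functional
        "\<lambda>x. delta (blinfun_apply g x)"]
    by (simp_all add: induced_map_def B)
qed

lemma norm_induced_map_le: "norm (induced_map g m) \<le> norm g * norm m"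
proof (rule norm_free_space_le)
  fix f
  have "\<bar>free_functional m (lip0_comp f g)\<bar> \<le> norm m * (norm g * norm f)"
    by (rule order_trans[OF abs_free_functional_le mult_left_mono[OF norm_lip0_comp_le]]) simp
  then show "\<bar>free_functional (induced_map g m) f\<bar> \<le> norm g * norm m * norm f"
    by (simp add: free_functional_induced_map ac_simps)
qed simp

lemma induced_map_compose: "induced_map (g o\<^sub>L h) m = induced_map g (induced_map h m)"
proof (rule free_space_eqI)
  fix f
  have "lip0_comp f (g o\<^sub>L h) = lip0_comp (lip0_comp f g) h"
    by (rule lip0_eqI) (simp add: lip0_comp.rep_eq)
  then show "free_functional (induced_map (g o\<^sub>L h) m) f =
      free_functional (induced_map g (induced_map h m)) f"
    by (simp add: free_functional_induced_map)
qed

text \<open>Under a functional \<open>\<phi>\<close> both sides become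
  \<open>free_functional m\<close> at the linear functional
  \<open>\<phi> o\<^sub>L g\<close>.\<close>

lemma barycenter_induced_map:
  "barycenter (induced_map g m) = blinfun_apply g (barycenter m :: 'a::banach)"
proof (rule blinfun_functionals_separate)
  fix \<phi> :: "'a \<Rightarrow>\<^sub>L real"
  have "lip0_comp (lip0_of_blinfun \<phi>) g = lip0_of_blinfun (\<phi> o\<^sub>L g)"
    by (rule lip0_eqI) (simp add: lip0_comp.rep_eq lip0_of_blinfun.rep_eq)
  then show "\<phi> (barycenter (induced_map g m)) = \<phi> (blinfun_apply g (barycenter m))"
    using blinfun_barycenter[of "\<phi> o\<^sub>L g" m]
    by (simp add: blinfun_barycenter[of \<phi> "induced_map g m"] free_functional_induced_map)
qed

section \<open>The Bochner integral in arbitrary Banach spaces\<close>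

text \<open>A functional maps approximating simple functions to approximating simple functions. For
  \<open>norm \<psi> \<le> 1\<close> the given error bounds the new one directly; a nonzero
  \<open>\<phi>\<close> is a multiple of such a \<open>\<psi>\<close>. This reduces vector integrals
  to real ones.\<close>

lemma has_bochner_integral_in_functional:
  fixes \<phi> :: "'b::real_normed_vector \<Rightarrow>\<^sub>L real"
  assumes "has_bochner_integral_in M f x"
  shows "has_bochner_integral M (\<lambda>y. \<phi> (f y)) (\<phi> x)"
proof -
  obtain s where f: "f \<in> borel_measurable M"
    and s: "\<And>i. Bochner_Integration.simple_bochner_integrable M (s i)"
    and approx: "(\<lambda>i. \<integral>\<^sup>+ y. ennreal (norm (f y - s i y)) \<partial>M) \<longlonglongrightarrow> 0"
    and lim: "(\<lambda>i. Bochner_Integration.simple_bochner_integral M (s i)) \<longlonglongrightarrow> x"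
    using assms unfolding has_bochner_integral_in_def by blast
  have contractive: "has_bochner_integral M (\<lambda>y. \<psi> (f y)) (\<psi> x)"
    if "norm \<psi> \<le> 1" for \<psi> :: "'b \<Rightarrow>\<^sub>L real"
  proof (rule has_bochner_integral.intros)
    show "(\<lambda>y. \<psi> (f y)) \<in> borel_measurable M"
      by (rule measurable_compose[OF f borel_measurable_continuous_onI])
        (intro continuous_intros)
    show "Bochner_Integration.simple_bochner_integrable M (\<lambda>y. \<psi> (s i y))" for i
      using simple_bochner_integrable_compose2[OF _ s s, of "\<lambda>a b. \<psi> a"]
      by (simp add: blinfun.zero_right)
    show "(\<lambda>i. \<integral>\<^sup>+ y. ennreal (norm (\<psi> (f y) - \<psi> (s i y))) \<partial>M) \<longlonglongrightarrow> 0"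
    proof (rule tendsto_sandwich[OF _ _ tendsto_const approx])
      have "norm (\<psi> z) \<le> norm z" for z
        using norm_blinfun[of \<psi> z] mult_right_mono[OF that, of "norm z"] by simp
      then show "\<forall>\<^sub>F i in sequentially. (\<integral>\<^sup>+ y. ennreal (norm (\<psi> (f y) - \<psi> (s i y))) \<partial>M)
          \<le> (\<integral>\<^sup>+ y. ennreal (norm (f y - s i y)) \<partial>M)"
        by (intro always_eventually allI nn_integral_mono ennreal_leI)
          (simp add: blinfun.diff_right[symmetric])
    qed simp
    have "Bochner_Integration.simple_bochner_integral M (\<lambda>y. \<psi> (s i y)) =
        \<psi> (Bochner_Integration.simple_bochner_integral M (s i))" for i
      by (rule simple_bochner_integral_linear[OF _ s])
        (rule bounded_linear.linear[OF blinfun.bounded_linear_right])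
    then show "(\<lambda>i. Bochner_Integration.simple_bochner_integral M (\<lambda>y. \<psi> (s i y))) \<longlonglongrightarrow> \<psi> x"
      using bounded_linear.tendsto[OF blinfun.bounded_linear_right lim] by simp
  qed
  show ?thesis
  proof (cases "\<phi> = 0")
    case False
    then have "has_bochner_integral M (\<lambda>y. norm \<phi> *\<^sub>R (inverse (norm \<phi>) *\<^sub>R \<phi>) (f y))
        (norm \<phi> *\<^sub>R (inverse (norm \<phi>) *\<^sub>R \<phi>) x)"
      by (intro has_bochner_integral_scaleR_right contractive) simp
    with False show ?thesis by (simp add: blinfun.scaleR_left mult.assoc[symmetric])
  qed (simp add: has_bochner_integral_zero)
qed

text \<open>Different approximating sequences cannot lead to different limits, since each functional
  sends the limit to a real integral. This justifies the definite description in
  \<open>bochner_integral\<close>.\<close>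

lemma has_bochner_integral_in_unique:
  assumes "has_bochner_integral_in M f x" "has_bochner_integral_in M f y"
  shows "x = y"
  by (rule blinfun_functionals_separate)
    (rule has_bochner_integral_eq[OF assms[THEN has_bochner_integral_in_functional]])

lemma has_bochner_integral_in_bochner_integral:
  assumes "bochner_integrable M f"
  shows "has_bochner_integral_in M f (bochner_integral M f)"
proof -
  obtain x where x: "has_bochner_integral_in M f x"
    using assms by (auto simp: bochner_integrable_def)
  then have "(THE x. has_bochner_integral_in M f x) = x"
    by (intro the_equality) (auto intro: has_bochner_integral_in_unique)
  with assms x show ?thesis by (simp add: bochner_integral_def)
qed

text \<open>A compact range is totally bounded, so finitely many centres of balls of radius
  \<open>e\<close> suffice as values of \<open>s\<close>.\<close>

lemma simple_function_approximation:
  assumes f: "f \<in> borel_measurable M" and compact: "compact (f ` space M)" and e: "e > 0"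
  obtains s where "simple_function M s" "\<And>y. y \<in> space M \<Longrightarrow> dist (f y) (s y) < e"
proof -
  obtain k where k: "finite k" "f ` space M \<subseteq> (\<Union>x\<in>k. ball x e)"
    using compact e unfolding compact_eq_totally_bounded by blast
  obtain xs where xs: "set xs = k" using finite_list[OF k(1)] by blast
  \<comment> \<open>Among the balls containing \<open>f y\<close> the first in the list is selected,
    which makes the choice of centre measurable.\<close>
  define i where "i y = (LEAST n. n < length xs \<and> dist (xs ! n) (f y) < e)" for y
  have i: "i y < length xs \<and> dist (xs ! i y) (f y) < e" if "y \<in> space M" for y
  proof -
    from that k(2) obtain x where "x \<in> set xs" "dist x (f y) < e" unfolding xs by auto
    then obtain n where "n < length xs \<and> dist (xs ! n) (f y) < e"
      by (auto simp: in_set_conv_nth)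
    then show ?thesis unfolding i_def by (rule LeastI)
  qed
  have "Measurable.pred M (\<lambda>y. n < length xs \<and> dist (xs ! n) (f y) < e)" for n
  proof -
    have "f -` ball (xs ! n) e \<inter> space M \<in> sets M"
      by (rule measurable_sets[OF f]) simp
    also have "f -` ball (xs ! n) e \<inter> space M = {y \<in> space M. dist (xs ! n) (f y) < e}"
      by auto
    finally show ?thesis by (cases "n < length xs") (simp_all add: pred_def)
  qed
  then have "i \<in> measurable M (count_space UNIV)"
    unfolding i_def by (rule measurable_Least)
  moreover have "finite (i ` space M)"
    by (rule finite_subset[of _ "{..<length xs}"]) (use i in auto)
  ultimately have "simple_function M i"
    by (auto simp: simple_function_def intro: measurable_sets)
  then have "simple_function M (\<lambda>y. xs ! i y)"
    by (rule simple_function_compose1)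
  then show ?thesis
    by (rule that) (use i in \<open>simp add: dist_commute[of "f _"]\<close>)
qed

text \<open>On a finite measure space uniform approximation is approximation in mean. The integrals
  of the approximants form a Cauchy sequence, whose limit exists because the target is
  complete.\<close>

lemma bochner_integrable_compact_range:
  fixes f :: "'a \<Rightarrow> 'b::banach"
  assumes M: "finite_measure M" and f: "f \<in> borel_measurable M" and compact: "compact (f ` space M)"
  shows "bochner_integrable M f"
proof -
  interpret finite_measure M by fact
  let ?I = "Bochner_Integration.simple_bochner_integral M"
  let ?m = "measure M (space M)"
  \<comment> \<open>\<open>Suc n\<close> keeps the tolerance positive at
    \<open>n = 0\<close>.\<close>
  define e where "e n = 1 / real (Suc n)" for n
  have e: "e n > 0" for n by (simp add: e_def)
  have "\<exists>s. simple_function M s \<and> (\<forall>y\<in>space M. dist (f y) (s y) < e n)" for n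
    by (rule simple_function_approximation[OF f compact e[of n]]) blast
  then obtain s where s: "\<And>n. simple_function M (s n)"
    and approx: "\<And>n y. y \<in> space M \<Longrightarrow> dist (f y) (s n y) < e n"
    by metis
  have sb: "Bochner_Integration.simple_bochner_integrable M (s n)" for n
    by (rule simple_bochner_integrable.intros[OF s]) simp
  have nn_le: "(\<integral>\<^sup>+ y. ennreal (g y) \<partial>M) \<le> ennreal (c * ?m)"
    if "\<And>y. y \<in> space M \<Longrightarrow> g y \<le> c" "c \<ge> 0" for g c
  proof -
    have "(\<integral>\<^sup>+ y. ennreal (g y) \<partial>M) \<le> (\<integral>\<^sup>+ y. ennreal c \<partial>M)"
      by (intro nn_integral_mono ennreal_leI that)
    also have "\<dots> = ennreal (c * ?m)"
      using that(2) by (simp add: emeasure_eq_measure ennreal_mult)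
    finally show ?thesis .
  qed
  have e_lim: "e \<longlonglongrightarrow> 0"
    unfolding e_def by (rule LIMSEQ_Suc[OF lim_1_over_n])
  have bound: "norm (?I (s m) - ?I (s n)) \<le> (e m + e n) * ?m" for m n
  proof -
    have diff: "Bochner_Integration.simple_bochner_integrable M (\<lambda>y. norm (s m y - s n y))"
      using simple_bochner_integrable_compose2[OF _ sb sb, of "\<lambda>a b. norm (a - b)"] by simp
    have "norm (?I (s m) - ?I (s n)) = norm (?I (\<lambda>y. s m y - s n y))"
      by (simp add: simple_bochner_integral_diff[OF sb sb])
    also have "\<dots> \<le> ?I (\<lambda>y. norm (s m y - s n y))"
      using simple_bochner_integrable_compose2[OF _ sb sb, of "(-)"]
      by (intro simple_bochner_integral_norm_bound) simp
    \<comment> \<open>The real integral is rewritten as a nonnegative extended one, so that the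
      uniform estimate \<open>nn_le\<close> applies.\<close>
    finally have "ennreal (norm (?I (s m) - ?I (s n))) \<le> (\<integral>\<^sup>+ y. norm (s m y - s n y) \<partial>M)"
      by (subst simple_bochner_integral_eq_nn_integral[OF diff, symmetric]) (simp_all add: ennreal_leI)
    also have "\<dots> \<le> ennreal ((e m + e n) * ?m)"
    proof (rule nn_le)
      fix y assume "y \<in> space M"
      then have "dist (f y) (s m y) < e m" "dist (f y) (s n y) < e n" by (simp_all add: approx)
      then show "norm (s m y - s n y) \<le> e m + e n"
        using dist_triangle3[of "s m y" "s n y" "f y"] by (simp add: dist_norm)
    qed (use e[of m] e[of n] in simp)
    finally show ?thesis
      using e[of m] e[of n] by (subst (asm) ennreal_le_iff) simp_all
  qed
  have "Cauchy (\<lambda>n. ?I (s n))"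
  proof (rule metric_CauchyI)
    fix r :: real assume r: "r > 0"
    have "(\<lambda>n. e n * ?m) \<longlonglongrightarrow> 0"
      using tendsto_mult_right[OF e_lim, of ?m] by simp
    then have "eventually (\<lambda>n. e n * ?m < r / 2) sequentially"
      by (rule order_tendstoD) (use r in simp)
    then obtain N where N: "\<And>n. n \<ge> N \<Longrightarrow> e n * ?m < r / 2"
      unfolding eventually_sequentially by blast
    show "\<exists>N. \<forall>m\<ge>N. \<forall>n\<ge>N. dist (?I (s m)) (?I (s n)) < r"
    proof (intro exI allI impI)
      fix m n assume "N \<le> m" "N \<le> n"
      with N[of m] N[of n] bound[of m n] show "dist (?I (s m)) (?I (s n)) < r"
        by (simp add: dist_norm distrib_right)
    qed
  qed
  then obtain x where x: "(\<lambda>n. ?I (s n)) \<longlonglongrightarrow> x"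
    using Cauchy_convergent_iff convergent_def by blast
  have "(\<lambda>n. \<integral>\<^sup>+ y. ennreal (norm (f y - s n y)) \<partial>M) \<longlonglongrightarrow> 0"
  proof (rule tendsto_sandwich[OF _ _ tendsto_const])
    show "\<forall>\<^sub>F n in sequentially. (\<integral>\<^sup>+ y. ennreal (norm (f y - s n y)) \<partial>M) \<le> ennreal (e n * ?m)"
      using approx e
      by (intro always_eventually allI nn_le) (auto simp: dist_norm intro: less_imp_le)
    have "(\<lambda>n. ennreal (e n * ?m)) \<longlonglongrightarrow> ennreal (0 * ?m)"
      by (intro tendsto_ennrealI tendsto_mult_right e_lim)
    then show "(\<lambda>n. ennreal (e n * ?m)) \<longlonglongrightarrow> 0" by simp
  qed simp
  with f sb x show ?thesis
    unfolding bochner_integrable_def has_bochner_integral_in_def by blast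
qed

section \<open>Integration of continuous functions on a compact space\<close>

lemma borel_measurable_continuous_map:
  assumes f: "continuous_map X euclidean f"
    and M: "space M = topspace X" "\<And>U. openin X U \<Longrightarrow> U \<in> sets M"
  shows "f \<in> borel_measurable M"
proof (rule borel_measurableI)
  fix S :: "'b set" assume "open S"
  with f have "openin X {x \<in> topspace X. f x \<in> S}"
    by (simp add: continuous_map_def)
  moreover have "{x \<in> topspace X. f x \<in> S} = f -` S \<inter> space M"
    using M(1) by auto
  ultimately show "f -` S \<inter> space M \<in> sets M" using M(2) by metis
qed

lemma bochner_integrable_continuous_map:
  fixes f :: "'a \<Rightarrow> 'b::banach"
  assumes "finite_measure M" and X: "compact_space X" and f: "continuous_map X euclidean f"
    and M: "space M = topspace X" "\<And>U. openin X U \<Longrightarrow> U \<in> sets M"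
  shows "bochner_integrable M f"
proof (rule bochner_integrable_compact_range)
  show "compact (f ` space M)"
    using image_compactin[OF _ f, of "topspace X"] X by (simp add: compact_space_def M(1))
qed (use assms in \<open>auto intro: borel_measurable_continuous_map\<close>)

lemma has_bochner_integral_abs_le:
  fixes f :: "'a \<Rightarrow> real"
  assumes M: "finite_measure M" and f: "has_bochner_integral M f I"
    and le: "\<And>x. x \<in> space M \<Longrightarrow> \<bar>f x\<bar> \<le> c"
  shows "\<bar>I\<bar> \<le> c * measure M (space M)"
proof -
  interpret finite_measure M by fact
  have int: "integrable M f" and I: "I = integral\<^sup>L M f"
    using f by (auto simp: has_bochner_integral_iff)
  have "\<bar>I\<bar> \<le> (\<integral>x. \<bar>f x\<bar> \<partial>M)"
    unfolding I by (rule integral_abs_bound)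
  also have "\<dots> \<le> (\<integral>x. c \<partial>M)"
    using int le by (intro integral_mono) auto
  finally show ?thesis by (simp add: mult.commute)
qed


section \<open>Averaging over a group of automorphisms\<close>

lemma tendsto_delta:
  assumes "(f \<longlongrightarrow> l) F" shows "((\<lambda>x. delta (f x)) \<longlongrightarrow> delta l) F"
  by (rule metric_tendsto_imp_tendsto[OF assms]) (simp add: dist_delta_le)

text \<open>Strong convergence passes to the induced maps: on \<open>delta x\<close> because
  \<open>delta\<close> does not increase distances, then on the span, then on the closure because
  the norms are uniformly bounded. The filter is arbitrary, as the group need not be
  metrizable.\<close>

lemma tendsto_induced_map:
  fixes g :: "'a::real_normed_vector \<Rightarrow>\<^sub>L 'a"
  assumes bound: "\<forall>\<^sub>F h in F. norm h \<le> C" and g: "norm g \<le> C"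
    and lim: "\<And>x. ((\<lambda>h. blinfun_apply h x) \<longlongrightarrow> blinfun_apply g x) F"
  shows "((\<lambda>h. induced_map h m) \<longlongrightarrow> induced_map g m) F"
proof (induction m rule: free_space_induct)
  case closed
  show ?case
    unfolding closed_sequential_limits mem_Collect_eq
  proof (intro allI impI, elim conjE)
    fix m :: "nat \<Rightarrow> 'a free_space" and l
    assume m: "\<forall>n. ((\<lambda>h. induced_map h (m n)) \<longlongrightarrow> induced_map g (m n)) F" and "m \<longlonglongrightarrow> l"
    show "((\<lambda>h. induced_map h l) \<longlongrightarrow> induced_map g l) F"
    proof (rule tendstoI)
      fix e :: real assume e: "e > 0"
      have C: "C \<ge> 0" using norm_ge_zero g by (rule order_trans)
      have "(\<lambda>n. C * dist (m n) l) \<longlonglongrightarrow> C * dist l l"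
        by (intro tendsto_intros) fact
      then have "\<forall>\<^sub>F n in sequentially. C * dist (m n) l < e / 3"
        by (rule order_tendstoD) (use e in simp)
      then obtain n where n: "C * dist (m n) l < e / 3"
        by (auto simp: eventually_sequentially)
      \<comment> \<open>One \<open>n\<close> serves all \<open>h\<close> with
        \<open>norm h \<le> C\<close> and also \<open>g\<close>; this uniformity supplies two of the
        three thirds of \<open>e\<close>.\<close>
      have le: "dist (induced_map h (m n)) (induced_map h l) < e / 3" if "norm h \<le> C" for h
      proof -
        have "dist (induced_map h (m n)) (induced_map h l) \<le> norm h * dist (m n) l"
          using norm_induced_map_le[of h "m n - l"] by (simp add: dist_norm blinfun.diff_right)
        also have "\<dots> \<le> C * dist (m n) l"
          using that by (rule mult_right_mono) simp
        finally show ?thesis using n by simp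
      qed
      have "\<forall>\<^sub>F h in F. dist (induced_map h (m n)) (induced_map g (m n)) < e / 3"
        using m e by (intro tendstoD) auto
      with bound show "\<forall>\<^sub>F h in F. dist (induced_map h l) (induced_map g l) < e"
      proof eventually_elim
        case (elim h)
        show ?case
          using elim(2) le[OF elim(1)] le[OF g]
            dist_triangle3[of "induced_map h l" "induced_map g (m n)" "induced_map h (m n)"]
            dist_triangle[of "induced_map h l" "induced_map g l" "induced_map g (m n)"]
          by (simp add: dist_commute)
      qed
    qed
  qed
next
  case zero
  show ?case by (simp add: blinfun.zero_right)
next
  case (scale_add c x m)
  then show ?case
    unfolding blinfun.add_right blinfun.scaleR_right induced_map_delta
    by (intro tendsto_add tendsto_scaleR tendsto_const tendsto_delta lim)
qed

text \<open>The set-theoretic inverse is exhibited as an element of \<open>G\<close>, so that norm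
  bounds valid on \<open>G\<close> apply to it too.\<close>

lemma automorphism_group_inverse:
  assumes "automorphism_group G" "g \<in> G"
  obtains g' where "g' \<in> G" "blinfun_apply g' = inv (blinfun_apply g)"
    "\<And>x. blinfun_apply g (blinfun_apply g' x) = x" "\<And>x. blinfun_apply g' (blinfun_apply g x) = x"
proof
  let ?g' = "Blinfun (inv (blinfun_apply g))"
  have bij: "bij (blinfun_apply g)" and bl: "bounded_linear (inv (blinfun_apply g))"
    using assms by (auto simp: automorphism_group_def automorphism_def)
  show "?g' \<in> G" using assms by (auto simp: automorphism_group_def)
  show app: "blinfun_apply ?g' = inv (blinfun_apply g)"
    by (rule bounded_linear_Blinfun_apply[OF bl])
  show "blinfun_apply g (blinfun_apply ?g' x) = x" "blinfun_apply ?g' (blinfun_apply g x) = x" for x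
    using bij by (simp_all add: app bij_is_surj surj_f_inv_f bij_is_inj inv_f_f)
qed

text \<open>With \<open>?y\<close> the preimage of \<open>x\<close> under the limit point
  \<open>g\<close>, the vector \<open>inv h x\<close> is split into \<open>?y\<close> and an
  increment. The increment tends to 0 and stays negligible under the uniformly bounded maps
  \<open>induced_map h\<close>; the fixed vector \<open>T ?y\<close> is handled by
  \<open>tendsto_induced_map\<close>.\<close>

lemma continuous_map_conjugate:
  fixes G :: "('a::real_normed_vector \<Rightarrow>\<^sub>L 'a) set"
  assumes G: "automorphism_group G" and C: "\<And>g. g \<in> G \<Longrightarrow> norm g \<le> C" and T: "bounded_linear T"
  shows "continuous_map (subtopology strong_operator_topology G) euclidean
    (\<lambda>g. induced_map g (T (inv (blinfun_apply g) x)))"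
  unfolding continuous_map_atin limitin_canonical_iff
proof
  let ?\<tau> = "subtopology strong_operator_topology G"
  interpret T: bounded_linear T by fact
  fix g assume "g \<in> topspace ?\<tau>"
  then have g: "g \<in> G" by simp
  let ?F = "atin ?\<tau> g"
  have "openin ?\<tau> G"
    using openin_topspace[of ?\<tau>] by (simp add: strong_operator_topology_topspace)
  with g have ev_G: "\<forall>\<^sub>F h in ?F. h \<in> G"
    unfolding eventually_atin by blast
  have lim: "((\<lambda>h. blinfun_apply h y) \<longlongrightarrow> blinfun_apply g y) ?F" for y
    using limitin_continuous_map[OF
        continuous_map_from_subtopology[OF strong_operator_topology_continuous_evaluation]
        \<open>g \<in> topspace ?\<tau>\<close> refl, of y]
    by simp
  obtain g' where g': "blinfun_apply g' = inv (blinfun_apply g)"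
    "\<And>x. blinfun_apply g (blinfun_apply g' x) = x"
    using automorphism_group_inverse[OF G g] by metis
  let ?y = "blinfun_apply g' x"
  have "((\<lambda>h. inv (blinfun_apply h) x - ?y) \<longlongrightarrow> 0) ?F"
  proof (rule Lim_null_comparison)
    show "\<forall>\<^sub>F h in ?F. norm (inv (blinfun_apply h) x - ?y) \<le> C * norm (blinfun_apply h ?y - blinfun_apply g ?y)"
      using ev_G
    proof eventually_elim
      case (elim h)
      obtain h' where h': "h' \<in> G" "blinfun_apply h' = inv (blinfun_apply h)"
        "\<And>x. blinfun_apply h' (blinfun_apply h x) = x"
        using automorphism_group_inverse[OF G elim] by metis
      \<comment> \<open>Writing \<open>x\<close> as \<open>g ?y\<close> and \<open>?y\<close> as
        \<open>h' (h ?y)\<close> expresses the increment through \<open>g ?y - h ?y\<close>, which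
        tends to 0. Boundedness of \<open>G\<close> thus makes inversion strongly
        continuous.\<close>
      have "inv (blinfun_apply h) x - ?y = blinfun_apply h' (blinfun_apply g ?y - blinfun_apply h ?y)"
        by (simp add: blinfun.diff_right h'(3) g'(2)) (simp add: h'(2))
      also have "norm \<dots> \<le> norm h' * norm (blinfun_apply g ?y - blinfun_apply h ?y)"
        by (rule norm_blinfun)
      also have "\<dots> \<le> C * norm (blinfun_apply h ?y - blinfun_apply g ?y)"
        using C[OF h'(1)] by (simp add: norm_minus_commute mult_right_mono)
      finally show ?case .
    qed
    have "((\<lambda>h. C * norm (blinfun_apply h ?y - blinfun_apply g ?y)) \<longlongrightarrow>
        C * norm (blinfun_apply g ?y - blinfun_apply g ?y)) ?F"
      by (intro tendsto_intros lim)
    then show "((\<lambda>h. C * norm (blinfun_apply h ?y - blinfun_apply g ?y)) \<longlongrightarrow> 0) ?F" by simp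
  qed
  then have "((\<lambda>h. C * norm (T (inv (blinfun_apply h) x - ?y))) \<longlongrightarrow> C * norm (T 0)) ?F"
    by (intro tendsto_mult tendsto_norm tendsto_const T.tendsto)
  then have "((\<lambda>h. C * norm (T (inv (blinfun_apply h) x - ?y))) \<longlongrightarrow> 0) ?F" by (simp add: T.zero)
  then have "((\<lambda>h. induced_map h (T (inv (blinfun_apply h) x - ?y))) \<longlongrightarrow> 0) ?F"
  proof (rule Lim_null_comparison[rotated])
    show "\<forall>\<^sub>F h in ?F. norm (induced_map h (T (inv (blinfun_apply h) x - ?y)))
        \<le> C * norm (T (inv (blinfun_apply h) x - ?y))"
      using ev_G
      by eventually_elim (rule order_trans[OF norm_induced_map_le mult_right_mono[OF C]], simp_all)
  qed
  moreover have "((\<lambda>h. induced_map h (T ?y)) \<longlongrightarrow> induced_map g (T ?y)) ?F"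
    by (rule tendsto_induced_map[OF eventually_mono[OF ev_G C] C[OF g] lim])
  ultimately have "((\<lambda>h. induced_map h (T (inv (blinfun_apply h) x - ?y)) + induced_map h (T ?y))
      \<longlongrightarrow> 0 + induced_map g (T ?y)) ?F"
    by (rule tendsto_add)
  then show "((\<lambda>h. induced_map h (T (inv (blinfun_apply h) x)))
      \<longlongrightarrow> induced_map g (T (inv (blinfun_apply g) x))) ?F"
    by (simp add: T.diff blinfun.diff_right g'(1))
qed

text \<open>Invariance of \<open>\<mu>\<close> is stated for images of sets, whereas the pushforward
  uses preimages. A preimage under translation by \<open>h\<close> is the image under translation by
  the inverse \<open>h'\<close>, so invariance at \<open>h'\<close> yields the claim.\<close>

lemma haar_measure_translate:
  fixes G :: "('a::real_normed_vector \<Rightarrow>\<^sub>L 'a) set"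
  assumes G: "automorphism_group G" and h: "h \<in> G"
    and \<mu>: "normalized_haar_measure (subtopology strong_operator_topology G) (o\<^sub>L) \<mu>"
  shows measurable_translate: "(\<lambda>k. h o\<^sub>L k) \<in> measurable \<mu> \<mu>"
    and distr_translate: "distr \<mu> \<mu> (\<lambda>k. h o\<^sub>L k) = \<mu>"
proof -
  let ?\<tau> = "subtopology strong_operator_topology G"
  have space: "space \<mu> = G" and sets: "sets \<mu> = sigma_sets G {U. openin ?\<tau> U}"
    and inv: "\<And>g A. g \<in> G \<Longrightarrow> A \<in> sets \<mu> \<Longrightarrow> emeasure \<mu> ((o\<^sub>L) g ` A) = emeasure \<mu> A"
    using \<mu> by (auto simp: normalized_haar_measure_def strong_operator_topology_topspace)
  have closed: "g o\<^sub>L k \<in> G" if "g \<in> G" "k \<in> G" for g k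
    using G that by (auto simp: automorphism_group_def)
  \<comment> \<open>Strong continuity of the translation is tested at one vector at a time.\<close>
  have "continuous_map ?\<tau> euclidean (\<lambda>k. blinfun_apply h (blinfun_apply k x))" for x
    using continuous_map_compose[OF
        continuous_map_from_subtopology[OF strong_operator_topology_continuous_evaluation],
        of euclidean "blinfun_apply h" G x]
    by (simp add: o_def linear_continuous_on blinfun.bounded_linear_right)
  then have cont: "continuous_map ?\<tau> ?\<tau> (\<lambda>k. h o\<^sub>L k)"
    using closed h
    by (auto simp: continuous_map_in_subtopology continuous_on_strong_operator_topo_iff_coordinatewise
        strong_operator_topology_topspace)
  show meas: "(\<lambda>k. h o\<^sub>L k) \<in> measurable \<mu> \<mu>"
  proof (rule measurable_sigma_sets[OF sets])
    show "{U. openin ?\<tau> U} \<subseteq> Pow G"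
      using openin_subset by fastforce
    show "(\<lambda>k. h o\<^sub>L k) \<in> space \<mu> \<rightarrow> G"
      using closed h by (auto simp: space)
    fix U assume "U \<in> {U. openin ?\<tau> U}"
    with cont have "openin ?\<tau> {k \<in> topspace ?\<tau>. h o\<^sub>L k \<in> U}"
      by (simp add: continuous_map_def)
    moreover have "{k \<in> topspace ?\<tau>. h o\<^sub>L k \<in> U} = (\<lambda>k. h o\<^sub>L k) -` U \<inter> space \<mu>"
      by (auto simp: space strong_operator_topology_topspace)
    ultimately show "(\<lambda>k. h o\<^sub>L k) -` U \<inter> space \<mu> \<in> sets \<mu>"
      unfolding sets by (auto intro: sigma_sets.Basic)
  qed
  obtain h' where h': "h' \<in> G" "\<And>x. blinfun_apply h (blinfun_apply h' x) = x"
    "\<And>x. blinfun_apply h' (blinfun_apply h x) = x"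
    using automorphism_group_inverse[OF G h] by metis
  have cancel: "h o\<^sub>L (h' o\<^sub>L k) = k" "h' o\<^sub>L (h o\<^sub>L k) = k" for k
    by (rule blinfun_eqI; simp add: h')+
  show "distr \<mu> \<mu> (\<lambda>k. h o\<^sub>L k) = \<mu>"
  proof (rule measure_eqI)
    fix A assume "A \<in> sets (distr \<mu> \<mu> (\<lambda>k. h o\<^sub>L k))"
    then have A: "A \<in> sets \<mu>" by simp
    then have "A \<subseteq> G" using sets.sets_into_space space by blast
    have "(\<lambda>k. h o\<^sub>L k) -` A \<inter> space \<mu> = (o\<^sub>L) h' ` A"
    proof (intro equalityI subsetI)
      fix k assume "k \<in> (\<lambda>k. h o\<^sub>L k) -` A \<inter> space \<mu>"
      then show "k \<in> (o\<^sub>L) h' ` A" using cancel(2)[of k] by (intro image_eqI[of _ _ "h o\<^sub>L k"]) auto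
    qed (use \<open>A \<subseteq> G\<close> h'(1) closed in \<open>auto simp: cancel space\<close>)
    then show "emeasure (distr \<mu> \<mu> (\<lambda>k. h o\<^sub>L k)) A = emeasure \<mu> A"
      by (simp add: emeasure_distr[OF meas A] inv[OF h'(1) A])
  qed simp
qed

theorem proposition18:
  fixes G :: "('a::banach \<Rightarrow>\<^sub>L 'a) set"
    and \<mu> :: "('a \<Rightarrow>\<^sub>L 'a) measure"
    and T\<^sub>0 T :: "'a \<Rightarrow> 'a free_space"
  assumes "lifting_property TYPE('a)"
    and "automorphism_group G"
    and "bounded G"
    and "compactin strong_operator_topology G"
    and "normalized_haar_measure (subtopology strong_operator_topology G) (o\<^sub>L) \<mu>"
    and "barycenter_right_inverse T\<^sub>0"
    and "\<And>x. T x =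
      bochner_integral \<mu> (\<lambda>g. induced_map g (T\<^sub>0 (inv (blinfun_apply g) x)))"
  shows "(\<forall>x. bochner_integrable \<mu> (\<lambda>g. induced_map g (T\<^sub>0 (inv (blinfun_apply g) x)))) \<and>
    barycenter_right_inverse T \<and>
    equivariant G T \<and>
    (onorm T\<^sub>0 \<le> 1 \<and> (\<forall>g\<in>G. \<forall>x. norm (blinfun_apply g x) = norm x) \<longrightarrow> onorm T \<le> 1)"
proof -
  let ?\<tau> = "subtopology strong_operator_topology G"
  define E where "E x g = induced_map g (T\<^sub>0 (inv (blinfun_apply g) x))" for x g
  note G = assms(2)
  have T0: "bounded_linear T\<^sub>0" "\<And>x. barycenter (T\<^sub>0 x) = x"
    using assms(6) by (auto simp: barycenter_right_inverse_def)
  interpret T0: bounded_linear T\<^sub>0 by fact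
  obtain C where C: "C > 0" "\<And>g. g \<in> G \<Longrightarrow> norm g \<le> C"
    using assms(3) by (auto simp: bounded_pos)
  have space: "space \<mu> = G" and sets: "sets \<mu> = sigma_sets G {U. openin ?\<tau> U}"
    and one: "emeasure \<mu> G = 1"
    using assms(5) by (auto simp: normalized_haar_measure_def strong_operator_topology_topspace)
  have fin: "finite_measure \<mu>"
    by (rule finite_measureI) (simp add: space one)
  interpret finite_measure \<mu> by fact
  have measure_one: "measure \<mu> (space \<mu>) = 1"
    by (simp add: measure_def space one)
  have inverse_linear: "linear (inv (blinfun_apply g))" if "g \<in> G" for g
    using G that by (auto simp: automorphism_group_def automorphism_def intro: bounded_linear.linear)

  have integrable: "bochner_integrable \<mu> (E x)" for x
  proof (rule bochner_integrable_continuous_map[OF fin])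
    show "compact_space ?\<tau>" using assms(4) by (rule compact_space_subtopology)
    show "continuous_map ?\<tau> euclidean (E x)"
      unfolding E_def by (rule continuous_map_conjugate[OF G C(2) T0(1)])
    show "space \<mu> = topspace ?\<tau>" by (simp add: space strong_operator_topology_topspace)
    show "U \<in> sets \<mu>" if "openin ?\<tau> U" for U
      using that by (auto simp: sets intro: sigma_sets.Basic)
  qed
  \<comment> \<open>From here on \<open>T\<close> is accessed only through these real
    integrals.\<close>
  have T_integral: "has_bochner_integral \<mu> (\<lambda>g. free_functional (E x g) f) (free_functional (T x) f)" for x f
  proof -
    have "has_bochner_integral_in \<mu> (E x) (T x)"
      using has_bochner_integral_in_bochner_integral[OF integrable]
      by (simp add: assms(7) E_def[abs_def])
    from has_bochner_integral_in_functional[OF this, of "Blinfun (\<lambda>m. free_functional m f)"]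
    show ?thesis
      by (simp add: bounded_linear_Blinfun_apply[OF bounded_linear_free_functional_apply])
  qed
  have T_eqI: "free_functional (T x) f = c"
    if "has_bochner_integral \<mu> u c" "\<And>g. g \<in> G \<Longrightarrow> free_functional (E x g) f = u g" for x f u c
  proof -
    have "has_bochner_integral \<mu> u (free_functional (T x) f)"
      using T_integral[of x f] has_bochner_integral_cong[OF refl that(2) refl, of \<mu>] space by simp
    from has_bochner_integral_eq[OF this that(1)] show ?thesis .
  qed
  \<comment> \<open>The bound \<open>K\<close> is left open to serve twice: \<open>K = C\<close>
    makes \<open>T\<close> bounded, and \<open>K = 1\<close> for isometries gives norm at most
    \<open>onorm T\<^sub>0\<close>.\<close>
  have T_le: "norm (T x) \<le> K * (onorm T\<^sub>0 * (K * norm x))"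
    if K: "K \<ge> 0" "\<And>g. g \<in> G \<Longrightarrow> norm g \<le> K" for K x
  proof (rule norm_free_space_le)
    show "0 \<le> K * (onorm T\<^sub>0 * (K * norm x))"
      using K(1) by (simp add: onorm_pos_le T0(1))
    have E_le: "norm (E x g) \<le> K * (onorm T\<^sub>0 * (K * norm x))" if g: "g \<in> G" for g
    proof -
      obtain g' where g': "g' \<in> G" "blinfun_apply g' = inv (blinfun_apply g)"
        using automorphism_group_inverse[OF G g] by metis
      have "norm (inv (blinfun_apply g) x) \<le> K * norm x"
        using norm_blinfun[of g' x] mult_right_mono[OF K(2)[OF g'(1)], of "norm x"] g'(2) by simp
      then have "norm (T\<^sub>0 (inv (blinfun_apply g) x)) \<le> onorm T\<^sub>0 * (K * norm x)"
        by (rule order_trans[OF onorm[OF T0(1)] mult_left_mono]) (rule onorm_pos_le[OF T0(1)])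
      then show ?thesis
        unfolding E_def
        by (rule order_trans[OF norm_induced_map_le mult_mono[OF K(2)[OF g]]]) (simp_all add: K(1))
    qed
    fix f
    have "\<bar>free_functional (T x) f\<bar> \<le> K * (onorm T\<^sub>0 * (K * norm x)) * norm f * measure \<mu> (space \<mu>)"
    proof (rule has_bochner_integral_abs_le[OF fin T_integral])
      fix g assume "g \<in> space \<mu>"
      then show "\<bar>free_functional (E x g) f\<bar> \<le> K * (onorm T\<^sub>0 * (K * norm x)) * norm f"
        by (intro order_trans[OF abs_free_functional_le mult_right_mono[OF E_le]]) (simp_all add: space)
    qed
    then show "\<bar>free_functional (T x) f\<bar> \<le> K * (onorm T\<^sub>0 * (K * norm x)) * norm f"
      by (simp add: measure_one)
  qed

  have "bounded_linear T"
  proof (rule bounded_linear_intro)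
    fix x y :: 'a and c :: real
    show "T (x + y) = T x + T y"
    proof (rule free_space_eqI, rule T_eqI)
      fix f
      show "has_bochner_integral \<mu> (\<lambda>g. free_functional (E x g) f + free_functional (E y g) f)
          (free_functional (T x + T y) f)"
        using has_bochner_integral_add[OF T_integral T_integral, of x f y f]
        by (simp add: free_space_rep_eqs blinfun.add_left)
      show "free_functional (E (x + y) g) f = free_functional (E x g) f + free_functional (E y g) f"
        if "g \<in> G" for g
        by (simp add: E_def linear_add[OF inverse_linear[OF that]] T0.add blinfun.add_right
            free_space_rep_eqs blinfun.add_left)
    qed
    show "T (c *\<^sub>R x) = c *\<^sub>R T x"
    proof (rule free_space_eqI, rule T_eqI)
      fix f
      show "has_bochner_integral \<mu> (\<lambda>g. c *\<^sub>R free_functional (E x g) f) (free_functional (c *\<^sub>R T x) f)"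
        using has_bochner_integral_scaleR_right[OF T_integral, of c x f]
        by (simp add: free_space_rep_eqs blinfun.scaleR_left)
      show "free_functional (E (c *\<^sub>R x) g) f = c *\<^sub>R free_functional (E x g) f" if "g \<in> G" for g
        by (simp add: E_def linear_scale[OF inverse_linear[OF that]] T0.scaleR blinfun.scaleR_right
            free_space_rep_eqs blinfun.scaleR_left)
    qed
    show "norm (T x) \<le> norm x * (C * onorm T\<^sub>0 * C)"
      using T_le[OF less_imp_le[OF C(1)] C(2), of x] by (simp add: ac_simps)
  qed
  moreover have "barycenter (T x) = x" for x
  proof (rule blinfun_functionals_separate)
    fix \<phi> :: "'a \<Rightarrow>\<^sub>L real"
    have "free_functional (T x) (lip0_of_blinfun \<phi>) = \<phi> x"
    proof (rule T_eqI)
      show "has_bochner_integral \<mu> (\<lambda>_. \<phi> x) (\<phi> x)"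
        by (simp add: has_bochner_integral_iff measure_one)
      fix g assume g: "g \<in> G"
      obtain g' where "blinfun_apply g' = inv (blinfun_apply g)"
        "\<And>x. blinfun_apply g (blinfun_apply g' x) = x"
        using automorphism_group_inverse[OF G g] by metis
      \<comment> \<open>Each value of the integrand already lies over \<open>x\<close>, because the
        barycenter map turns \<open>induced_map g\<close> into \<open>g\<close>, which cancels the
        inverse inside.\<close>
      then have "barycenter (E x g) = x"
        by (simp add: E_def barycenter_induced_map T0(2))
      then show "free_functional (E x g) (lip0_of_blinfun \<phi>) = \<phi> x"
        using blinfun_barycenter[of \<phi> "E x g"] by simp
    qed
    then show "\<phi> (barycenter (T x)) = \<phi> x" by (simp add: blinfun_barycenter)
  qed
  moreover have "equivariant G T"
    unfolding equivariant_def
  proof (intro ballI allI free_space_eqI)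
    fix h x f assume h: "h \<in> G"
    note meas = measurable_translate[OF G h assms(5)]
    let ?u = "\<lambda>g. free_functional (E (blinfun_apply h x) g) f"
    \<comment> \<open>The inverse of \<open>h o\<^sub>L k\<close> sends \<open>h x\<close> to the
      preimage of \<open>x\<close> under \<open>k\<close>, so translating the integrand pulls out
      \<open>induced_map h\<close>. Moving it to the test function as \<open>lip0_comp f h\<close>
      avoids commuting it with a vector integral.\<close>
    have u: "?u (h o\<^sub>L k) = free_functional (E x k) (lip0_comp f h)" if k: "k \<in> G" for k
    proof -
      have bij: "bij (blinfun_apply h)" "bij (blinfun_apply k)"
        using G h k by (auto simp: automorphism_group_def automorphism_def)
      have "blinfun_apply (h o\<^sub>L k) = blinfun_apply h \<circ> blinfun_apply k"
        by (simp add: fun_eq_iff)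
      then have "inv (blinfun_apply (h o\<^sub>L k)) = inv (blinfun_apply k) \<circ> inv (blinfun_apply h)"
        by (simp only: o_inv_distrib[OF bij])
      then have "E (blinfun_apply h x) (h o\<^sub>L k) = induced_map h (E x k)"
        by (simp add: E_def induced_map_compose inv_f_f bij_is_inj[OF bij(1)])
      then show ?thesis by (simp add: free_functional_induced_map)
    qed
    have u_int: "has_bochner_integral \<mu> ?u (free_functional (T (blinfun_apply h x)) f)"
      by (rule T_integral)
    then have "free_functional (T (blinfun_apply h x)) f = integral\<^sup>L \<mu> ?u"
      by (simp add: has_bochner_integral_iff)
    also have "\<dots> = integral\<^sup>L (distr \<mu> \<mu> (\<lambda>k. h o\<^sub>L k)) ?u"
      by (simp add: distr_translate[OF G h assms(5)])
    also have "\<dots> = (\<integral>k. ?u (h o\<^sub>L k) \<partial>\<mu>)"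
      by (rule integral_distr[OF meas borel_measurable_has_bochner_integral[OF u_int]])
    also have "\<dots> = (\<integral>k. free_functional (E x k) (lip0_comp f h) \<partial>\<mu>)"
      by (rule Bochner_Integration.integral_cong) (simp_all add: u space)
    also have "\<dots> = free_functional (T x) (lip0_comp f h)"
      using T_integral[of x "lip0_comp f h"] by (simp add: has_bochner_integral_iff)
    finally show "free_functional (T (blinfun_apply h x)) f = free_functional (induced_map h (T x)) f"
      by (simp add: free_functional_induced_map)
  qed
  moreover have "onorm T \<le> 1"
    if "onorm T\<^sub>0 \<le> 1" and isometry: "\<forall>g\<in>G. \<forall>x. norm (blinfun_apply g x) = norm x"
  proof (rule onorm_bound)
    fix x
    have "norm g \<le> 1" if "g \<in> G" for g
      using isometry that by (intro norm_blinfun_bound) simp_all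
    then have "norm (T x) \<le> onorm T\<^sub>0 * norm x"
      using T_le[of 1 x] by simp
    also have "\<dots> \<le> 1 * norm x"
      using that(1) by (rule mult_right_mono) simp
    finally show "norm (T x) \<le> 1 * norm x" .
  qed simp
  ultimately show ?thesis
    using integrable unfolding E_def[abs_def] barycenter_right_inverse_def by blast
qed

end
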